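(* Let $\mathcal L$ be an unbounded continuous signature, $\{M_i : i\in I\}$ a family of $\mathcal L$-structures, $\mathcal U$ an ultrafilter on $I$, and let $\prod M_i/\mathcal U$ be the (unbounded) ultraproduct. Then for every $\mathcal L$-formula $\varphi(\bar x)$ and all elements $[a_i],[b_i],\ldots\in\prod M_i/\mathcal U$: $$\varphi([a_i],[b_i],\ldots)^{\prod M_i/\mathcal U}=\lim_{\mathcal U}\varphi(a_i,b_i,\ldots)^{M_i}.$$
   Context: Gauged spaces. A gauged space $(X,d,\nu)$ is a metric space $(X,d)$ with a $1$-Lipschitz function $\nu:X\to\mathbb R$ such that $\{x:\nu(x)\le r\}$ is $d$-bounded for every $r\in\mathbb R$. A continuity modulus is a non-decreasing left-continuous $\delta:(0,\infty)\to(0,\infty)$. A map $f:X\to Y$ of gauged spaces respects $\delta$ under $\nu$ if for every $\varepsilon>0$ and $x,y\in X$: if $\nu(x),\nu(y)<1/\varepsilon$ and $d(x,y)<\delta(\varepsilon)$, then $d(f(x),f(y))\le\varepsilon$ and $\nu(f(x))\le 1/\delta(\varepsilon)$. Finite products are gauged by $d(\bar x,\bar y)=\max_i d(x_i,y_i)$, $\nu(\bar x)=\max_i\nu(x_i)$ (the empty product is a point with $\nu=0$); $\mathbb R^+=[0,\infty)$ has $d(x,y)=|x-y|$, $\nu(x)=x$. Structures. An unbounded signature $\mathcal L$ consists of function and predicate symbols with arities, a continuity modulus $\delta_s$ for each symbol $s$, and includes a distinguished binary predicate $d$ and unary predicate $\nu$ (single-sorted for simplicity). An $\mathcal L$-structure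 is a complete, possibly empty, gauged space $(M,d^M,\nu^M)$ with maps $f^M:M^n\to M$, $P^M:M^n\to\mathbb R^+$ for function and predicate symbols (including $d,\nu$), each respecting $\delta_f$, $\delta_P$ under $\nu$. Formulae. Write $x\dot- y=\max(x-y,0)$. Terms and atomic formulae $P(\bar t)$ are as usual. Formulae, the properties "bounded" and "eventually constant (e.c.) in $x$", the bound $B_\varphi$ (for bounded $\varphi$), the threshold $C_{\varphi,x}$ and the formula $\varphi(\infty,\bar y)$ (for $\varphi(x,\bar y)$ e.c. in $x$) are defined by induction. (1) An atomic formula is e.c. in $x$ if $x$ does not occur in it; it is never bounded. (2) Formulae are closed under the connectives $1$, $\dot-$, $+$, $x/2$. If $\theta$ is a connective and all $\psi_i$ are bounded then $\theta(\bar\psi)$ is bounded, $B_{\theta(\bar\psi)}=\sup_{\bar x\in\prod[0,B_{\psi_i}]}\theta(\bar x)$; if all $\psi_i$ are e.c. in $x$ so is $\theta(\bar\psi)$, its value at $\infty$ is $\theta(\overline{\psi(\infty,\bar y)})$ and its threshold is $\max_i C_{\psi_i,x}$. If $\psi$ is bounded then $\psi\dot-\chi$ is bounded with bound $B_\psi$ for any $\chi$, and $\psi\dot-\nu(x)$ is e.c. in $x$ with value $0$ at $x=\infty$ and threshold $B_\psi$. (3) If (and only if) $\psi$ is e.c. in $x$, $\sup_x\psi$ and $\inf_x\psi$ are formulae; they are e.c. in $x$; if $\psi$ is bounded so are they, with bound $B_\psi$; if $\psi$ is e.c. in $z\ne x$ so are they, with threshold $C_{\psi,z}$ and value at $z=\infty$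 equal to $\sup_x$ (resp. $\inf_x$) of $\psi$ with $z=\infty$. (4) If $\varphi$ is e.c. in $x$ and $x$ is not free in $\varphi$, then $\varphi(\infty,\bar y)=\varphi$, $C_{\varphi,x}=0$. (Overlapping clauses agree.) Semantics. Terms, atomic formulae and connectives are interpreted by composition; $(\inf_x\varphi(x,\bar a))^M=\inf_{b\in M\cup\{\infty\}}\varphi(b,\bar a)^M$ and $(\sup_x\varphi(x,\bar a))^M=\sup_{b\in M\cup\{\infty\}}\varphi(b,\bar a)^M$, where $\infty$ is a formal element at which the value is that of the formula $\varphi(\infty,\bar a)$. Ultraproduct. Let $I_0=\{i:M_i\ne\emptyset\}$. If $I_0\in\mathcal U$ let $N_0=\{(a_i)\in\prod_{i\in I_0}M_i:\lim_{\mathcal U}\nu^{M_i}(a_i)<\infty\}$, otherwise $N_0=\emptyset$. Put $f^{N_0}((a_i),(b_i),\ldots)=(f^{M_i}(a_i,b_i,\ldots))$ and $P^{N_0}((a_i),(b_i),\ldots)=\lim_{\mathcal U}P^{M_i}(a_i,b_i,\ldots)$ (all predicates, including $d,\nu$). Then $\prod M_i/\mathcal U$ is the structure obtained from $N_0$ by identifying points at distance $0$ and completing; $[a_i]$ is the image of $(a_i)\in N_0$. *)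

theory Defs
  imports "HOL-Analysis.Analysis"
begin

section \<open>Gauged spaces\<close>

text \<open>The locale \<^locale>\<open>Metric_space\<close> also constrains the distance outside the carrier
  (non-negativity and symmetry), so a distance is cut off there before it is applied.\<close>

definition cut :: "'a set \<Rightarrow> ('a \<Rightarrow> 'a \<Rightarrow> real) \<Rightarrow> 'a \<Rightarrow> 'a \<Rightarrow> real" where
  "cut X d x y = (if x \<in> X \<and> y \<in> X then d x y else 0)"

definition gauged_space :: "'a set \<Rightarrow> ('a \<Rightarrow> 'a \<Rightarrow> real) \<Rightarrow> ('a \<Rightarrow> real) \<Rightarrow> bool" where
  "gauged_space X d \<nu> \<longleftrightarrow>
     Metric_space X (cut X d) \<and>
     (\<forall>x\<in>X. \<forall>y\<in>X. \<bar>\<nu> x - \<nu> y\<bar> \<le> d x y) \<and>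
     (\<forall>r. Metric_space.mbounded X (cut X d) {x \<in> X. \<nu> x \<le> r})"

definition complete_gauged_space :: "'a set \<Rightarrow> ('a \<Rightarrow> 'a \<Rightarrow> real) \<Rightarrow> ('a \<Rightarrow> real) \<Rightarrow> bool" where
  "complete_gauged_space X d \<nu> \<longleftrightarrow>
     gauged_space X d \<nu> \<and> Metric_space.mcomplete X (cut X d)"

definition continuity_modulus :: "(real \<Rightarrow> real) \<Rightarrow> bool" where
  "continuity_modulus \<delta> \<longleftrightarrow>
     (\<forall>\<epsilon>>0. \<delta> \<epsilon> > 0) \<and> mono_on {0<..} \<delta> \<and> (\<forall>\<epsilon>>0. continuous (at_left \<epsilon>) \<delta>)"

definition respects_modulus ::
  "(real \<Rightarrow> real) \<Rightarrow> 'a set \<Rightarrow> ('a \<Rightarrow> 'a \<Rightarrow> real) \<Rightarrow> ('a \<Rightarrow> real) \<Rightarrow>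
   ('b \<Rightarrow> 'b \<Rightarrow> real) \<Rightarrow> ('b \<Rightarrow> real) \<Rightarrow> ('a \<Rightarrow> 'b) \<Rightarrow> bool" where
  "respects_modulus \<delta> X d g d' g' f \<longleftrightarrow>
     (\<forall>\<epsilon>>0. \<forall>x\<in>X. \<forall>y\<in>X.
        g x < 1 / \<epsilon> \<and> g y < 1 / \<epsilon> \<and> d x y < \<delta> \<epsilon> \<longrightarrow>
        d' (f x) (f y) \<le> \<epsilon> \<and> g' (f x) \<le> 1 / \<delta> \<epsilon>)"

text \<open>Finite powers of a gauged space; tuples are lists.\<close>

definition tuples :: "nat \<Rightarrow> 'a set \<Rightarrow> 'a list set" where
  "tuples n X = {xs. set xs \<subseteq> X \<and> length xs = n}"

definition tuple_dist :: "('a \<Rightarrow> 'a \<Rightarrow> real) \<Rightarrow> 'a list \<Rightarrow> 'a list \<Rightarrow> real" where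
  "tuple_dist d xs ys = (if xs = [] then 0 else Max {d (xs ! i) (ys ! i) |i. i < length xs})"

definition tuple_gauge :: "('a \<Rightarrow> real) \<Rightarrow> 'a list \<Rightarrow> real" where
  "tuple_gauge \<nu> xs = (if xs = [] then 0 else Max (\<nu> ` set xs))"


section \<open>Signatures and structures\<close>

record ('f, 'p) signature =
  fun_syms :: "'f set"
  pred_syms :: "'p set"
  fun_arity :: "'f \<Rightarrow> nat"
  pred_arity :: "'p \<Rightarrow> nat"
  fun_modulus :: "'f \<Rightarrow> real \<Rightarrow> real"
  pred_modulus :: "'p \<Rightarrow> real \<Rightarrow> real"
  dist_sym :: 'p
  gauge_sym :: 'p

definition is_signature :: "('f, 'p) signature \<Rightarrow> bool" where
  "is_signature L \<longleftrightarrow>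
     (\<forall>f \<in> fun_syms L. continuity_modulus (fun_modulus L f)) \<and>
     (\<forall>P \<in> pred_syms L. continuity_modulus (pred_modulus L P)) \<and>
     dist_sym L \<in> pred_syms L \<and> pred_arity L (dist_sym L) = 2 \<and>
     gauge_sym L \<in> pred_syms L \<and> pred_arity L (gauge_sym L) = 1"

record ('a, 'f, 'p) struct =
  univ :: "'a set"
  fun_interp :: "'f \<Rightarrow> 'a list \<Rightarrow> 'a"
  pred_interp :: "'p \<Rightarrow> 'a list \<Rightarrow> real"

definition sdist :: "('f, 'p) signature \<Rightarrow> ('a, 'f, 'p) struct \<Rightarrow> 'a \<Rightarrow> 'a \<Rightarrow> real" where
  "sdist L M x y = pred_interp M (dist_sym L) [x, y]"

definition sgauge :: "('f, 'p) signature \<Rightarrow> ('a, 'f, 'p) struct \<Rightarrow> 'a \<Rightarrow> real" where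
  "sgauge L M x = pred_interp M (gauge_sym L) [x]"

definition is_structure :: "('f, 'p) signature \<Rightarrow> ('a, 'f, 'p) struct \<Rightarrow> bool" where
  "is_structure L M \<longleftrightarrow>
     complete_gauged_space (univ M) (sdist L M) (sgauge L M) \<and>
     (\<forall>f \<in> fun_syms L.
        fun_interp M f \<in> tuples (fun_arity L f) (univ M) \<rightarrow> univ M \<and>
        respects_modulus (fun_modulus L f)
          (tuples (fun_arity L f) (univ M)) (tuple_dist (sdist L M)) (tuple_gauge (sgauge L M))
          (sdist L M) (sgauge L M) (fun_interp M f)) \<and>
     (\<forall>P \<in> pred_syms L.
        pred_interp M P \<in> tuples (pred_arity L P) (univ M) \<rightarrow> {0..} \<and>
        respects_modulus (pred_modulus L P)
          (tuples (pred_arity L P) (univ M)) (tuple_dist (sdist L M)) (tuple_gauge (sgauge L M))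
          dist (\<lambda>r. r) (pred_interp M P))"


section \<open>Formulae\<close>

datatype 'f tm = Var nat | Fn 'f "'f tm list"

primrec fv_tm :: "'f tm \<Rightarrow> nat set" where
  "fv_tm (Var v) = {v}"
| "fv_tm (Fn f ts) = \<Union> (set (map fv_tm ts))"

primrec is_term :: "('f, 'p) signature \<Rightarrow> 'f tm \<Rightarrow> bool" where
  "is_term L (Var v) \<longleftrightarrow> True"
| "is_term L (Fn f ts) \<longleftrightarrow>
     f \<in> fun_syms L \<and> length ts = fun_arity L f \<and> list_all (\<lambda>b. b) (map (is_term L) ts)"

text \<open>Raw expressions; \<open>is_formula\<close> below selects the formulae among them.\<close>

datatype ('f, 'p) fm =
    Atom 'p "'f tm list"
  | One
  | Monus "('f, 'p) fm" "('f, 'p) fm"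
  | Plus "('f, 'p) fm" "('f, 'p) fm"
  | Half "('f, 'p) fm"
  | SupF nat "('f, 'p) fm"
  | InfF nat "('f, 'p) fm"

primrec fv :: "('f, 'p) fm \<Rightarrow> nat set" where
  "fv (Atom P ts) = (\<Union>t\<in>set ts. fv_tm t)"
| "fv One = {}"
| "fv (Monus \<phi> \<psi>) = fv \<phi> \<union> fv \<psi>"
| "fv (Plus \<phi> \<psi>) = fv \<phi> \<union> fv \<psi>"
| "fv (Half \<phi>) = fv \<phi>"
| "fv (SupF x \<phi>) = fv \<phi> - {x}"
| "fv (InfF x \<phi>) = fv \<phi> - {x}"

text \<open>The numerical bound of a bounded formula and the threshold of an eventually constant one
  enter neither the definition of the formulae nor their semantics, so only the properties
  themselves and the formula at infinity are defined.\<close>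

text \<open>In the clause for \<open>Monus\<close>, boundedness of the first argument suffices; the case of two
  bounded arguments is included.\<close>

primrec bounded_fm :: "('f, 'p) fm \<Rightarrow> bool" where
  "bounded_fm (Atom P ts) \<longleftrightarrow> False"
| "bounded_fm One \<longleftrightarrow> True"
| "bounded_fm (Monus \<phi> \<psi>) \<longleftrightarrow> bounded_fm \<phi>"
| "bounded_fm (Plus \<phi> \<psi>) \<longleftrightarrow> bounded_fm \<phi> \<and> bounded_fm \<psi>"
| "bounded_fm (Half \<phi>) \<longleftrightarrow> bounded_fm \<phi>"
| "bounded_fm (SupF x \<phi>) \<longleftrightarrow> bounded_fm \<phi>"
| "bounded_fm (InfF x \<phi>) \<longleftrightarrow> bounded_fm \<phi>"

abbreviation gauge_atom :: "('f, 'p) signature \<Rightarrow> nat \<Rightarrow> ('f, 'p) fm" where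
  "gauge_atom L x \<equiv> Atom (gauge_sym L) [Var x]"

primrec ev_const :: "('f, 'p) signature \<Rightarrow> nat \<Rightarrow> ('f, 'p) fm \<Rightarrow> bool" where
  "ev_const L x (Atom P ts) \<longleftrightarrow> x \<notin> (\<Union>t\<in>set ts. fv_tm t)"
| "ev_const L x One \<longleftrightarrow> True"
| "ev_const L x (Monus \<phi> \<psi>) \<longleftrightarrow>
     (ev_const L x \<phi> \<and> ev_const L x \<psi>) \<or> (bounded_fm \<phi> \<and> \<psi> = gauge_atom L x)"
| "ev_const L x (Plus \<phi> \<psi>) \<longleftrightarrow> ev_const L x \<phi> \<and> ev_const L x \<psi>"
| "ev_const L x (Half \<phi>) \<longleftrightarrow> ev_const L x \<phi>"
| "ev_const L x (SupF z \<phi>) \<longleftrightarrow> x = z \<or> ev_const L x \<phi>"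
| "ev_const L x (InfF z \<phi>) \<longleftrightarrow> x = z \<or> ev_const L x \<phi>"

primrec is_formula :: "('f, 'p) signature \<Rightarrow> ('f, 'p) fm \<Rightarrow> bool" where
  "is_formula L (Atom P ts) \<longleftrightarrow>
     P \<in> pred_syms L \<and> length ts = pred_arity L P \<and> (\<forall>t\<in>set ts. is_term L t)"
| "is_formula L One \<longleftrightarrow> True"
| "is_formula L (Monus \<phi> \<psi>) \<longleftrightarrow> is_formula L \<phi> \<and> is_formula L \<psi>"
| "is_formula L (Plus \<phi> \<psi>) \<longleftrightarrow> is_formula L \<phi> \<and> is_formula L \<psi>"
| "is_formula L (Half \<phi>) \<longleftrightarrow> is_formula L \<phi>"
| "is_formula L (SupF x \<phi>) \<longleftrightarrow> is_formula L \<phi> \<and> ev_const L x \<phi>"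
| "is_formula L (InfF x \<phi>) \<longleftrightarrow> is_formula L \<phi> \<and> ev_const L x \<phi>"

text \<open>\<open>at_inf L x \<phi>\<close> is the formula obtained from \<open>\<phi>\<close> by letting \<open>x = \<infinity>\<close>; it is meaningful
  only if \<open>\<phi>\<close> is eventually constant in \<open>x\<close>. The formula \<open>0\<close> is expressed as \<open>1\<close> monus \<open>1\<close>.
  Since \<open>\<nu>(x)\<close> is not eventually constant in \<open>x\<close>, the two cases for \<open>Monus\<close> do not overlap.\<close>

primrec at_inf :: "('f, 'p) signature \<Rightarrow> nat \<Rightarrow> ('f, 'p) fm \<Rightarrow> ('f, 'p) fm" where
  "at_inf L x (Atom P ts) = Atom P ts"
| "at_inf L x One = One"
| "at_inf L x (Monus \<phi> \<psi>) =
     (if \<psi> = gauge_atom L x then Monus One One else Monus (at_inf L x \<phi>) (at_inf L x \<psi>))"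
| "at_inf L x (Plus \<phi> \<psi>) = Plus (at_inf L x \<phi>) (at_inf L x \<psi>)"
| "at_inf L x (Half \<phi>) = Half (at_inf L x \<phi>)"
| "at_inf L x (SupF z \<phi>) = (if x = z then SupF z \<phi> else SupF z (at_inf L x \<phi>))"
| "at_inf L x (InfF z \<phi>) = (if x = z then InfF z \<phi> else InfF z (at_inf L x \<phi>))"

lemma at_inf_not_free: "x \<notin> fv \<phi> \<Longrightarrow> at_inf L x \<phi> = \<phi>"
  by (induction \<phi>) auto

lemma ev_const_not_free: "x \<notin> fv \<phi> \<Longrightarrow> ev_const L x \<phi>"
  by (induction \<phi>) auto

lemma fv_at_inf: "ev_const L x \<phi> \<Longrightarrow> fv (at_inf L x \<phi>) \<subseteq> fv \<phi> - {x}"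
  by (induction \<phi>) auto

lemma bounded_at_inf: "bounded_fm \<phi> \<Longrightarrow> bounded_fm (at_inf L x \<phi>)"
  by (induction \<phi>) auto

lemma ev_const_at_inf: "ev_const L z \<phi> \<Longrightarrow> ev_const L z (at_inf L x \<phi>)"
  by (induction \<phi>) (auto simp: bounded_at_inf)

lemma is_formula_at_inf: "is_formula L \<phi> \<Longrightarrow> is_formula L (at_inf L x \<phi>)"
  by (induction \<phi>) (auto simp: ev_const_at_inf)


section \<open>Semantics\<close>

primrec eval_tm :: "('a, 'f, 'p) struct \<Rightarrow> (nat \<Rightarrow> 'a) \<Rightarrow> 'f tm \<Rightarrow> 'a" where
  "eval_tm M s (Var v) = s v"
| "eval_tm M s (Fn f ts) = fun_interp M f (map (eval_tm M s) ts)"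

primrec fm_size :: "('f, 'p) fm \<Rightarrow> nat" where
  "fm_size (Atom P ts) = 1"
| "fm_size One = 1"
| "fm_size (Monus \<phi> \<psi>) = fm_size \<phi> + fm_size \<psi> + 1"
| "fm_size (Plus \<phi> \<psi>) = fm_size \<phi> + fm_size \<psi> + 1"
| "fm_size (Half \<phi>) = fm_size \<phi> + 1"
| "fm_size (SupF x \<phi>) = fm_size \<phi> + 1"
| "fm_size (InfF x \<phi>) = fm_size \<phi> + 1"

lemma fm_size_pos: "Suc 0 \<le> fm_size \<phi>"
  by (induction \<phi>) auto

lemma fm_size_at_inf: "fm_size (at_inf L x \<phi>) \<le> fm_size \<phi>"
  by (induction \<phi>) (auto simp: fm_size_pos)

text \<open>Assignments are total functions, but only the values at the free variables matter, so that
  sentences are evaluated in the empty structure as well. A quantifier ranges over the universe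
  and a formal element \<open>\<infinity>\<close>, whose contribution is the value of \<open>at_inf L x \<phi>\<close>.\<close>

function eval ::
  "('f, 'p) signature \<Rightarrow> ('a, 'f, 'p) struct \<Rightarrow> (nat \<Rightarrow> 'a) \<Rightarrow> ('f, 'p) fm \<Rightarrow> real" where
  "eval L M s (Atom P ts) = pred_interp M P (map (eval_tm M s) ts)"
| "eval L M s One = 1"
| "eval L M s (Monus \<phi> \<psi>) = max (eval L M s \<phi> - eval L M s \<psi>) 0"
| "eval L M s (Plus \<phi> \<psi>) = eval L M s \<phi> + eval L M s \<psi>"
| "eval L M s (Half \<phi>) = eval L M s \<phi> / 2"
| "eval L M s (SupF x \<phi>) =
     Sup (insert (eval L M s (at_inf L x \<phi>)) ((\<lambda>b. eval L M (s(x := b)) \<phi>) ` univ M))"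
| "eval L M s (InfF x \<phi>) =
     Inf (insert (eval L M s (at_inf L x \<phi>)) ((\<lambda>b. eval L M (s(x := b)) \<phi>) ` univ M))"
  by pat_completeness auto
termination
  by (relation "Wellfounded.measure (\<lambda>(L, M, s, \<phi>). fm_size \<phi>)")
     (auto simp: fm_size_at_inf le_imp_less_Suc)


section \<open>Ultraproducts\<close>

definition ultrafilter :: "'i filter \<Rightarrow> bool" where
  "ultrafilter U \<longleftrightarrow>
     U \<noteq> bot \<and> (\<forall>P. eventually P U \<or> eventually (\<lambda>i. \<not> P i) U)"

definition nonempty_indices :: "('i \<Rightarrow> ('a, 'f, 'p) struct) \<Rightarrow> 'i set" where
  "nonempty_indices M = {i. univ (M i) \<noteq> {}}"

text \<open>The limit of the gauges is taken in the extended reals, where it always exists.\<close>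

definition pre_ultraproduct ::
  "('f, 'p) signature \<Rightarrow> 'i filter \<Rightarrow> ('i \<Rightarrow> ('a, 'f, 'p) struct) \<Rightarrow> ('i \<Rightarrow> 'a, 'f, 'p) struct"
where
  "pre_ultraproduct L U M =
     \<lparr> univ =
         (if eventually (\<lambda>i. i \<in> nonempty_indices M) U
          then {a \<in> Pi\<^sub>E (nonempty_indices M) (\<lambda>i. univ (M i)).
                  Lim U (\<lambda>i. ereal (sgauge L (M i) (a i))) < \<infinity>}
          else {}),
       fun_interp =
         (\<lambda>f as. restrict (\<lambda>i. fun_interp (M i) f (map (\<lambda>a. a i) as)) (nonempty_indices M)),
       pred_interp =
         (\<lambda>P as. Lim U (\<lambda>i. pred_interp (M i) P (map (\<lambda>a. a i) as))) \<rparr>"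

text \<open>Identifying points at distance zero and completing, in one step: the elements of the
  completion of a pre-structure \<open>N\<close>, in which the distance is only a pseudometric, are the Cauchy
  sequences modulo distance tending to zero. A point of \<open>N\<close> is sent to the class of the constant
  sequence, and the symbols are extended by continuity, that is, along representatives.\<close>

definition cauchy_seqs :: "('f, 'p) signature \<Rightarrow> ('b, 'f, 'p) struct \<Rightarrow> (nat \<Rightarrow> 'b) set" where
  "cauchy_seqs L N =
     {s. range s \<subseteq> univ N \<and> (\<forall>\<epsilon>>0. \<exists>k. \<forall>m\<ge>k. \<forall>n\<ge>k. sdist L N (s m) (s n) < \<epsilon>)}"

definition cauchy_rel ::
  "('f, 'p) signature \<Rightarrow> ('b, 'f, 'p) struct \<Rightarrow> ((nat \<Rightarrow> 'b) \<times> (nat \<Rightarrow> 'b)) set" where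
  "cauchy_rel L N =
     {(s, t). s \<in> cauchy_seqs L N \<and> t \<in> cauchy_seqs L N \<and>
              (\<lambda>n. sdist L N (s n) (t n)) \<longlonglongrightarrow> 0}"

definition seq_rep :: "(nat \<Rightarrow> 'b) set \<Rightarrow> nat \<Rightarrow> 'b" where
  "seq_rep X = (SOME s. s \<in> X)"

definition completion_struct ::
  "('f, 'p) signature \<Rightarrow> ('b, 'f, 'p) struct \<Rightarrow> ((nat \<Rightarrow> 'b) set, 'f, 'p) struct" where
  "completion_struct L N =
     \<lparr> univ = cauchy_seqs L N // cauchy_rel L N,
       fun_interp =
         (\<lambda>f Xs. cauchy_rel L N `` {\<lambda>n. fun_interp N f (map (\<lambda>X. seq_rep X n) Xs)}),
       pred_interp =
         (\<lambda>P Xs. lim (\<lambda>n. pred_interp N P (map (\<lambda>X. seq_rep X n) Xs))) \<rparr>"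

definition completion_embed ::
  "('f, 'p) signature \<Rightarrow> ('b, 'f, 'p) struct \<Rightarrow> 'b \<Rightarrow> (nat \<Rightarrow> 'b) set" where
  "completion_embed L N a = cauchy_rel L N `` {\<lambda>n. a}"

definition ultraproduct ::
  "('f, 'p) signature \<Rightarrow> 'i filter \<Rightarrow> ('i \<Rightarrow> ('a, 'f, 'p) struct) \<Rightarrow>
   ((nat \<Rightarrow> 'i \<Rightarrow> 'a) set, 'f, 'p) struct" where
  "ultraproduct L U M = completion_struct L (pre_ultraproduct L U M)"

definition ultra_class ::
  "('f, 'p) signature \<Rightarrow> 'i filter \<Rightarrow> ('i \<Rightarrow> ('a, 'f, 'p) struct) \<Rightarrow> ('i \<Rightarrow> 'a) \<Rightarrow>
   (nat \<Rightarrow> 'i \<Rightarrow> 'a) set" where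
  "ultra_class L U M a = completion_embed L (pre_ultraproduct L U M) a"

end

theory Submission
  imports Defs
begin

text \<open>The theorem is proved by induction on the size of \<open>\<phi>\<close>; only the quantifiers need an idea.
  The threshold of an eventually constant formula is uniform over all structures (the size of the
  formula will do), so a witness for a value in \<open>M i\<close> either lies below the threshold, and then such
  witnesses assemble to a point of the pre-ultraproduct, or may be replaced by \<open>\<infinity>\<close>. Conversely,
  formulae are uniformly continuous on gauge balls, so their values on the ultraproduct are
  approximated by values on the dense image of the pre-ultraproduct.\<close>

section \<open>Suprema and infima of sets of reals\<close>

text \<open>The value of a quantified formula involves \<open>at_inf L x \<psi>\<close>, which is
  not a subformula of it. Inductions about values therefore run on \<open>fm_size\<close>, and each
  fact about \<open>\<psi>\<close> is paired with the same fact about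
  \<open>at_inf L x \<psi>\<close>.

  The obstacle is that a quantifier ranges over an unbounded space while a modulus controls only
  gauge balls. The threshold cuts the range down to a ball together with \<open>\<infinity>\<close>,
  and this is used three times: for finiteness of suprema, for uniform continuity and for the limit
  along \<open>U\<close>. The size is a bound because bounded formulae start from
  \<open>One\<close>, contain atoms only inside subtrahends, and add values only by
  \<open>Plus\<close>; it is a threshold because thresholds arise only from \<open>\<psi>\<close>
  monus \<open>\<nu>(x)\<close>, where any bound of \<open>\<psi>\<close> is one.

  The pre-ultraproduct and its completion are both limits, along \<open>U\<close> and along
  sequences. Moduli have strict inequalities as hypotheses and non-strict ones as conclusions, so
  they survive either limit.\<close>

lemma Sup_close:
  fixes A B :: "real set"
  assumes "A \<noteq> {}" "B \<noteq> {}" "bdd_above A" "bdd_above B"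
    and "\<And>a. a \<in> A \<Longrightarrow> \<exists>b\<in>B. \<bar>a - b\<bar> \<le> e"
    and "\<And>b. b \<in> B \<Longrightarrow> \<exists>a\<in>A. \<bar>a - b\<bar> \<le> e"
  shows "\<bar>Sup A - Sup B\<bar> \<le> e"
proof -
  have "Sup A \<le> Sup B + e"
    using assms by (intro cSup_least) (force dest: cSup_upper)+
  moreover have "Sup B \<le> Sup A + e"
    using assms by (intro cSup_least) (force dest: cSup_upper)+
  ultimately show ?thesis by linarith
qed

lemma Inf_close:
  fixes A B :: "real set"
  assumes "A \<noteq> {}" "B \<noteq> {}" "bdd_below A" "bdd_below B"
    and "\<And>a. a \<in> A \<Longrightarrow> \<exists>b\<in>B. \<bar>a - b\<bar> \<le> e"
    and "\<And>b. b \<in> B \<Longrightarrow> \<exists>a\<in>A. \<bar>a - b\<bar> \<le> e"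
  shows "\<bar>Inf A - Inf B\<bar> \<le> e"
proof -
  have "\<bar>Sup (uminus ` A) - Sup (uminus ` B)\<bar> \<le> e"
    using assms by (intro Sup_close) (force simp: bdd_above_uminus abs_minus_commute)+
  then show ?thesis by (simp add: Inf_real_def)
qed

text \<open>The two estimates are of different strength: a single element of \<open>A\<close> close
  to \<open>Sup A\<close> bounds \<open>Sup (S i)\<close> from below, so \<open>lower\<close> may
  depend on \<open>a\<close>, whereas the bound from above has to treat all \<open>y\<close> in
  \<open>S i\<close> at once.\<close>

lemma tendsto_Sup:
  fixes A :: "real set" and S :: "'i \<Rightarrow> real set"
  assumes "A \<noteq> {}" "bdd_above A" "\<And>i. S i \<noteq> {}"
    and bdd: "eventually (\<lambda>i. bdd_above (S i)) F"
    and lower: "\<And>a e. a \<in> A \<Longrightarrow> 0 < e \<Longrightarrow> eventually (\<lambda>i. \<exists>y\<in>S i. \<bar>y - a\<bar> < e) F"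
    and upper: "\<And>e. 0 < e \<Longrightarrow> eventually (\<lambda>i. \<forall>y\<in>S i. \<exists>a\<in>A. \<bar>y - a\<bar> < e) F"
  shows "((\<lambda>i. Sup (S i)) \<longlongrightarrow> Sup A) F"
proof (rule tendstoI)
  fix e :: real assume "0 < e"
  then have "0 < e / 2" by simp
  obtain a where "a \<in> A" "Sup A - e / 2 < a"
    using less_cSupE[of "Sup A - e / 2" A] assms(1) \<open>0 < e / 2\<close> by auto
  show "eventually (\<lambda>i. dist (Sup (S i)) (Sup A) < e) F"
    using lower[OF \<open>a \<in> A\<close> \<open>0 < e / 2\<close>] upper[OF \<open>0 < e / 2\<close>] bdd
  proof eventually_elim
    case (elim i)
    then obtain y where "y \<in> S i" "\<bar>y - a\<bar> < e / 2" by blast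
    then have "Sup A - e < Sup (S i)"
      using \<open>Sup A - e / 2 < a\<close> cSup_upper[OF \<open>y \<in> S i\<close> \<open>bdd_above (S i)\<close>] by linarith
    moreover have "Sup (S i) \<le> Sup A + e / 2"
    proof (rule cSup_least[OF assms(3)])
      fix y assume "y \<in> S i"
      then obtain a' where "a' \<in> A" "\<bar>y - a'\<bar> < e / 2" using elim by blast
      then show "y \<le> Sup A + e / 2" using cSup_upper[OF \<open>a' \<in> A\<close> assms(2)] by linarith
    qed
    ultimately show ?case using \<open>0 < e\<close> by (simp add: dist_real_def)
  qed
qed

lemma tendsto_Inf:
  fixes A :: "real set" and S :: "'i \<Rightarrow> real set"
  assumes "A \<noteq> {}" "bdd_below A" "\<And>i. S i \<noteq> {}"
    and bdd: "eventually (\<lambda>i. bdd_below (S i)) F"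
    and lower: "\<And>a e. a \<in> A \<Longrightarrow> 0 < e \<Longrightarrow> eventually (\<lambda>i. \<exists>y\<in>S i. \<bar>y - a\<bar> < e) F"
    and upper: "\<And>e. 0 < e \<Longrightarrow> eventually (\<lambda>i. \<forall>y\<in>S i. \<exists>a\<in>A. \<bar>y - a\<bar> < e) F"
  shows "((\<lambda>i. Inf (S i)) \<longlongrightarrow> Inf A) F"
proof -
  have *: "\<bar>a - y\<bar> = \<bar>y - a\<bar>" for a y :: real by simp
  have "((\<lambda>i. Sup (uminus ` S i)) \<longlongrightarrow> Sup (uminus ` A)) F"
    using assms by (intro tendsto_Sup) (auto simp: bdd_above_uminus *)
  then show ?thesis unfolding Inf_real_def by (rule tendsto_minus)
qed


section \<open>Formulae\<close>

lemma finite_fv_tm: "finite (fv_tm t)"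
  by (induction t) auto

lemma finite_fv: "finite (fv \<phi>)"
  by (induction \<phi>) (auto simp: finite_fv_tm)

text \<open>At \<open>Monus\<close>, \<open>at_inf\<close> tests whether the subtrahend is literally
  \<open>\<nu>(x)\<close>. For two substitutions of \<open>\<infinity>\<close> to commute, neither
  may change the outcome of the other's test.\<close>

lemma at_inf_eq_gauge_atom: "at_inf L x \<phi> = gauge_atom L z \<longleftrightarrow> \<phi> = gauge_atom L z"
  by (cases \<phi>) auto

lemma at_inf_commute: "at_inf L x (at_inf L z \<phi>) = at_inf L z (at_inf L x \<phi>)"
  by (induction \<phi>) (auto simp: at_inf_eq_gauge_atom)

lemma eval_tm_cong: "(\<And>v. v \<in> fv_tm t \<Longrightarrow> s v = s' v) \<Longrightarrow> eval_tm M s t = eval_tm M s' t"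
proof (induction t)
  case (Fn f ts)
  then have "map (eval_tm M s) ts = map (eval_tm M s') ts" by fastforce
  then show ?case by (simp only: eval_tm.simps)
qed simp

text \<open>\<open>is_formula\<close> matters here: only for a formula eventually constant in
  \<open>x\<close> does \<open>at_inf\<close> remove \<open>x\<close> from the free variables, so
  that the contribution of \<open>\<infinity>\<close> depends on the right variables.\<close>

lemma eval_cong:
  "is_formula L \<phi> \<Longrightarrow> (\<And>v. v \<in> fv \<phi> \<Longrightarrow> s v = s' v) \<Longrightarrow> eval L M s \<phi> = eval L M s' \<phi>"
proof (induction \<phi> arbitrary: s s' rule: measure_induct_rule[where f = fm_size])
  case (less \<phi>)
  have quant: "eval L M s (at_inf L x \<psi>) = eval L M s' (at_inf L x \<psi>)"
      "eval L M (s(x := b)) \<psi> = eval L M (s'(x := b)) \<psi>"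
    if "fm_size \<psi> < fm_size \<phi>" "is_formula L \<psi>" "ev_const L x \<psi>" "fv \<psi> - {x} = fv \<phi>" for x \<psi> b
  proof -
    show "eval L M s (at_inf L x \<psi>) = eval L M s' (at_inf L x \<psi>)"
      using that fv_at_inf[OF that(3)] le_less_trans[OF fm_size_at_inf that(1)]
      by (intro less.IH less.prems) (auto simp: is_formula_at_inf)
    show "eval L M (s(x := b)) \<psi> = eval L M (s'(x := b)) \<psi>"
      using that by (intro less.IH) (auto intro: less.prems)
  qed
  show ?case
  proof (cases \<phi>)
    case (Atom P ts)
    with less.prems have "map (eval_tm M s) ts = map (eval_tm M s') ts"
      by (auto intro: eval_tm_cong)
    then show ?thesis by (simp only: Atom eval.simps)
  next
    case (Monus \<psi> \<xi>)
    then show ?thesis using less.IH[of \<psi> s s'] less.IH[of \<xi> s s'] less.prems by simp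
  next
    case (Plus \<psi> \<xi>)
    then show ?thesis using less.IH[of \<psi> s s'] less.IH[of \<xi> s s'] less.prems by simp
  next
    case (Half \<psi>)
    then show ?thesis using less.IH[of \<psi> s s'] less.prems by simp
  next
    case (SupF x \<psi>)
    then show ?thesis using quant[of \<psi> x] less.prems by simp
  next
    case (InfF x \<psi>)
    then show ?thesis using quant[of \<psi> x] less.prems by simp
  qed simp
qed


section \<open>Pre-structures\<close>

text \<open>For argument lists of symbols: as they are finite, bounds found for each term
  separately, uniformly in the assignment, merge into one. \<open>list_radius\<close> does the same
  for radii of continuity.\<close>

lemma list_bound:
  assumes "\<And>t. t \<in> set ts \<Longrightarrow> \<exists>R::real. \<forall>s. Q s t \<longrightarrow> h s t < R"
  shows "\<exists>R. \<forall>s. \<forall>t\<in>set ts. Q s t \<longrightarrow> h s t < R"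
  using assms
proof (induction ts)
  case (Cons t ts)
  then obtain R where R: "\<forall>s. \<forall>t\<in>set ts. Q s t \<longrightarrow> h s t < R" by auto
  obtain R' where "\<forall>s. Q s t \<longrightarrow> h s t < R'" using Cons.prems by auto
  with R show ?case by (intro exI[of _ "max R R'"]) (fastforce simp: less_max_iff_disj)
qed simp

lemma list_radius:
  assumes "\<And>t. t \<in> set ts \<Longrightarrow> \<exists>\<delta>>0::real. \<forall>p. Q p t \<delta>"
    and "\<And>p t \<delta> \<delta>'. Q p t \<delta> \<Longrightarrow> \<delta>' \<le> \<delta> \<Longrightarrow> Q p t \<delta>'"
  shows "\<exists>\<delta>>0. \<forall>p. \<forall>t\<in>set ts. Q p t \<delta>"
  using assms(1)
proof (induction ts)
  case (Cons t ts)
  then obtain \<delta> where \<delta>: "0 < \<delta>" "\<forall>p. \<forall>t\<in>set ts. Q p t \<delta>" by auto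
  obtain \<delta>' where \<delta>': "0 < \<delta>'" "\<forall>p. Q p t \<delta>'" using Cons.prems by auto
  have "Q p u (min \<delta> \<delta>')" if "u \<in> set (t # ts)" for p u
    using that \<delta>(2) \<delta>'(2) assms(2)[of p u _ "min \<delta> \<delta>'"] by fastforce
  then show ?case using \<delta>(1) \<delta>'(1) by (intro exI[of _ "min \<delta> \<delta>'"]) auto
qed (auto intro: exI[of _ 1])

text \<open>The distance is only a pseudometric and need not be complete, so that the given structures,
  the pre-ultraproduct and its completion are all instances.\<close>

locale pre_structure =
  fixes L :: "('f, 'p) signature" and N :: "('a, 'f, 'p) struct"
  assumes signature: "is_signature L"
    and dist_refl: "x \<in> univ N \<Longrightarrow> sdist L N x x = 0"
    and dist_sym: "x \<in> univ N \<Longrightarrow> y \<in> univ N \<Longrightarrow> sdist L N x y = sdist L N y x"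
    and dist_triangle: "x \<in> univ N \<Longrightarrow> y \<in> univ N \<Longrightarrow> z \<in> univ N \<Longrightarrow>
      sdist L N x z \<le> sdist L N x y + sdist L N y z"
    and gauge_lipschitz: "x \<in> univ N \<Longrightarrow> y \<in> univ N \<Longrightarrow>
      \<bar>sgauge L N x - sgauge L N y\<bar> \<le> sdist L N x y"
    and fun_closed: "f \<in> fun_syms L \<Longrightarrow> length xs = fun_arity L f \<Longrightarrow> set xs \<subseteq> univ N \<Longrightarrow>
      fun_interp N f xs \<in> univ N"
    and pred_nonneg: "P \<in> pred_syms L \<Longrightarrow> length xs = pred_arity L P \<Longrightarrow> set xs \<subseteq> univ N \<Longrightarrow>
      0 \<le> pred_interp N P xs"
    and fun_respects: "f \<in> fun_syms L \<Longrightarrow> length xs = fun_arity L f \<Longrightarrow>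
      set xs \<subseteq> univ N \<Longrightarrow> set ys \<subseteq> univ N \<Longrightarrow> 0 < e \<Longrightarrow>
      (\<And>x. x \<in> set xs \<union> set ys \<Longrightarrow> sgauge L N x < 1 / e) \<Longrightarrow>
      list_all2 (\<lambda>x y. sdist L N x y < fun_modulus L f e) xs ys \<Longrightarrow>
      sdist L N (fun_interp N f xs) (fun_interp N f ys) \<le> e \<and>
      sgauge L N (fun_interp N f xs) \<le> 1 / fun_modulus L f e"
    and pred_respects: "P \<in> pred_syms L \<Longrightarrow> length xs = pred_arity L P \<Longrightarrow>
      set xs \<subseteq> univ N \<Longrightarrow> set ys \<subseteq> univ N \<Longrightarrow> 0 < e \<Longrightarrow>
      (\<And>x. x \<in> set xs \<union> set ys \<Longrightarrow> sgauge L N x < 1 / e) \<Longrightarrow>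
      list_all2 (\<lambda>x y. sdist L N x y < pred_modulus L P e) xs ys \<Longrightarrow>
      \<bar>pred_interp N P xs - pred_interp N P ys\<bar> \<le> e \<and>
      pred_interp N P xs \<le> 1 / pred_modulus L P e"
begin

abbreviation "D \<equiv> sdist L N"
abbreviation "G \<equiv> sgauge L N"
abbreviation "E \<equiv> eval L N"

text \<open>Only the variables in \<open>V\<close> are constrained, so sentences can be treated in
  an empty structure too.\<close>

definition in_ball :: "real \<Rightarrow> nat set \<Rightarrow> (nat \<Rightarrow> 'a) \<Rightarrow> bool" where
  "in_ball r V s \<longleftrightarrow> (\<forall>v\<in>V. s v \<in> univ N \<and> G (s v) < r)"

text \<open>Both quantifiers are the supremum and the infimum of this one set, so most estimates are
  made once, for its elements.\<close>

definition quant_vals :: "(nat \<Rightarrow> 'a) \<Rightarrow> nat \<Rightarrow> ('f, 'p) fm \<Rightarrow> real set" where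
  "quant_vals s x \<phi> = insert (E s (at_inf L x \<phi>)) ((\<lambda>b. E (s(x := b)) \<phi>) ` univ N)"

lemma eval_SupF: "E s (SupF x \<phi>) = Sup (quant_vals s x \<phi>)"
  and eval_InfF: "E s (InfF x \<phi>) = Inf (quant_vals s x \<phi>)"
  by (simp_all add: quant_vals_def)

lemma quant_vals_nonempty: "quant_vals s x \<phi> \<noteq> {}"
  by (simp add: quant_vals_def)

lemma modulus_pos:
  shows "f \<in> fun_syms L \<Longrightarrow> 0 < e \<Longrightarrow> 0 < fun_modulus L f e"
    and "P \<in> pred_syms L \<Longrightarrow> 0 < e \<Longrightarrow> 0 < pred_modulus L P e"
  using signature by (auto simp: is_signature_def continuity_modulus_def)

lemma dist_nonneg: "x \<in> univ N \<Longrightarrow> y \<in> univ N \<Longrightarrow> 0 \<le> D x y"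
  using signature pred_nonneg[of "dist_sym L" "[x, y]"]
  by (simp add: is_signature_def sdist_def)

lemma gauge_nonneg: "x \<in> univ N \<Longrightarrow> 0 \<le> G x"
  using signature pred_nonneg[of "gauge_sym L" "[x]"]
  by (simp add: is_signature_def sgauge_def)

text \<open>The parameter \<open>e'\<close> of a modulus governs both the accuracy \<open>e'\<close>
  and the radius \<open>1 / e'\<close>. Decreasing it improves both, so any accuracy can be had on
  any ball.\<close>

lemma modulus_radius:
  fixes r e :: real
  assumes "0 < e"
  obtains e' where "0 < e'" "e' < e" "r \<le> 1 / e'"
proof
  let ?e' = "min (e / 2) (1 / max 1 r)"
  show "0 < ?e'" "?e' < e" using assms by auto
  have "r \<le> 1 / (1 / max 1 r)" by simp
  also have "\<dots> \<le> 1 / ?e'" using assms by (intro divide_left_mono) auto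
  finally show "r \<le> 1 / ?e'" .
qed

text \<open>The modulus ties accuracy to radius; this form, with \<open>r\<close> and
  \<open>e\<close> chosen independently, is the one that composes.\<close>

lemma fun_uniformly_continuous:
  assumes "f \<in> fun_syms L" "0 < e"
  obtains \<delta> where "0 < \<delta>"
    "\<And>xs ys. length xs = fun_arity L f \<Longrightarrow> set xs \<subseteq> univ N \<Longrightarrow> set ys \<subseteq> univ N \<Longrightarrow>
      (\<And>x. x \<in> set xs \<union> set ys \<Longrightarrow> G x < r) \<Longrightarrow> list_all2 (\<lambda>x y. D x y < \<delta>) xs ys \<Longrightarrow>
      D (fun_interp N f xs) (fun_interp N f ys) < e"
proof -
  obtain e' where e': "0 < e'" "e' < e" "r \<le> 1 / e'" using modulus_radius[OF assms(2)] .
  show thesis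
  proof (rule that[of "fun_modulus L f e'"])
    show "0 < fun_modulus L f e'" using assms e' modulus_pos by blast
  next
    fix xs ys
    assume *: "length xs = fun_arity L f" "set xs \<subseteq> univ N" "set ys \<subseteq> univ N"
      "\<And>x. x \<in> set xs \<union> set ys \<Longrightarrow> G x < r"
      "list_all2 (\<lambda>x y. D x y < fun_modulus L f e') xs ys"
    have "G x < 1 / e'" if "x \<in> set xs \<union> set ys" for x
      using *(4)[OF that] e' by linarith
    then show "D (fun_interp N f xs) (fun_interp N f ys) < e"
      using fun_respects[OF assms(1) *(1-3) e'(1) _ *(5)] e'(2) by fastforce
  qed
qed

lemma pred_uniformly_continuous:
  assumes "P \<in> pred_syms L" "0 < e"
  obtains \<delta> where "0 < \<delta>"
    "\<And>xs ys. length xs = pred_arity L P \<Longrightarrow> set xs \<subseteq> univ N \<Longrightarrow> set ys \<subseteq> univ N \<Longrightarrow>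
      (\<And>x. x \<in> set xs \<union> set ys \<Longrightarrow> G x < r) \<Longrightarrow> list_all2 (\<lambda>x y. D x y < \<delta>) xs ys \<Longrightarrow>
      \<bar>pred_interp N P xs - pred_interp N P ys\<bar> < e"
proof -
  obtain e' where e': "0 < e'" "e' < e" "r \<le> 1 / e'" using modulus_radius[OF assms(2)] .
  show thesis
  proof (rule that[of "pred_modulus L P e'"])
    show "0 < pred_modulus L P e'" using assms e' modulus_pos by blast
  next
    fix xs ys
    assume *: "length xs = pred_arity L P" "set xs \<subseteq> univ N" "set ys \<subseteq> univ N"
      "\<And>x. x \<in> set xs \<union> set ys \<Longrightarrow> G x < r"
      "list_all2 (\<lambda>x y. D x y < pred_modulus L P e') xs ys"
    have "G x < 1 / e'" if "x \<in> set xs \<union> set ys" for x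
      using *(4)[OF that] e' by linarith
    then show "\<bar>pred_interp N P xs - pred_interp N P ys\<bar> < e"
      using pred_respects[OF assms(1) *(1-3) e'(1) _ *(5)] e'(2) by fastforce
  qed
qed

text \<open>The modulus is applied to the pair \<open>xs\<close>, \<open>xs\<close>, whose
  coordinates are at distance 0, below the positive modulus.\<close>

lemma fun_gauge_bound:
  assumes "f \<in> fun_syms L" "length xs = fun_arity L f" "set xs \<subseteq> univ N" "0 < e"
    and "\<And>x. x \<in> set xs \<Longrightarrow> G x < 1 / e"
  shows "G (fun_interp N f xs) \<le> 1 / fun_modulus L f e"
proof -
  have "list_all2 (\<lambda>x y. D x y < fun_modulus L f e) xs xs"
    using assms by (auto simp: list_all2_same dist_refl modulus_pos subset_iff)
  then show ?thesis using fun_respects[OF assms(1-3,3,4)] assms(5) by blast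
qed

lemma pred_bound:
  assumes "P \<in> pred_syms L" "length xs = pred_arity L P" "set xs \<subseteq> univ N" "0 < e"
    and "\<And>x. x \<in> set xs \<Longrightarrow> G x < 1 / e"
  shows "pred_interp N P xs \<le> 1 / pred_modulus L P e"
proof -
  have "list_all2 (\<lambda>x y. D x y < pred_modulus L P e) xs xs"
    using assms by (auto simp: list_all2_same dist_refl modulus_pos subset_iff)
  then show ?thesis using pred_respects[OF assms(1-3,3,4)] assms(5) by blast
qed

section \<open>Terms on gauge balls: bounds and uniform continuity\<close>

lemma eval_tm_closed:
  "is_term L t \<Longrightarrow> (\<And>v. v \<in> fv_tm t \<Longrightarrow> s v \<in> univ N) \<Longrightarrow> eval_tm N s t \<in> univ N"
proof (induction t)
  case (Fn f ts)
  then have "eval_tm N s t \<in> univ N" if "t \<in> set ts" for t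
    using that by (auto simp: list_all_iff)
  with Fn.prems show ?case by (auto intro!: fun_closed)
qed simp

lemma map_eval_tm_closed:
  "(\<And>t. t \<in> set ts \<Longrightarrow> is_term L t) \<Longrightarrow> (\<And>v. v \<in> (\<Union>t\<in>set ts. fv_tm t) \<Longrightarrow> s v \<in> univ N) \<Longrightarrow>
    set (map (eval_tm N s) ts) \<subseteq> univ N"
  by (auto intro!: eval_tm_closed)

lemma in_ball_subset: "in_ball r W s \<Longrightarrow> V \<subseteq> W \<Longrightarrow> in_ball r V s"
  by (auto simp: in_ball_def)

lemma eval_tm_bounded:
  "is_term L t \<Longrightarrow> \<exists>R. \<forall>s. in_ball r (fv_tm t) s \<longrightarrow> G (eval_tm N s t) < R"
proof (induction t)
  case (Var v)
  then show ?case by (auto simp: in_ball_def)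
next
  case (Fn f ts)
  have "\<exists>R. \<forall>s. \<forall>t\<in>set ts. in_ball r (fv_tm t) s \<longrightarrow> G (eval_tm N s t) < R"
    using Fn by (intro list_bound) (auto simp: list_all_iff)
  then obtain R where R: "\<And>s t. t \<in> set ts \<Longrightarrow> in_ball r (fv_tm t) s \<Longrightarrow> G (eval_tm N s t) < R"
    by blast
  \<comment> \<open>Only the gauge bound is wanted from the modulus, so the accuracy 1 is
    arbitrary.\<close>
  obtain e where e: "0 < e" "R \<le> 1 / e" using modulus_radius[of 1 R] by auto
  show ?case
  \<comment> \<open>The summand 1 turns the non-strict bound of the modulus into a strict
    one.\<close>
  proof (intro exI[of _ "1 / fun_modulus L f e + 1"] allI impI)
    fix s assume s: "in_ball r (fv_tm (Fn f ts)) s"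
    then have s': "in_ball r (fv_tm t) s" if "t \<in> set ts" for t
      using that by (force intro: in_ball_subset)
    have "G x < 1 / e" if "x \<in> set (map (eval_tm N s) ts)" for x
      using that R s' e(2) by fastforce
    moreover have "set (map (eval_tm N s) ts) \<subseteq> univ N"
      using Fn.prems s' by (intro map_eval_tm_closed) (auto simp: list_all_iff in_ball_def)
    ultimately have "G (fun_interp N f (map (eval_tm N s) ts)) \<le> 1 / fun_modulus L f e"
      using Fn.prems e(1) by (intro fun_gauge_bound) auto
    then show "G (eval_tm N s (Fn f ts)) < 1 / fun_modulus L f e + 1" by simp
  qed
qed

lemma eval_tm_list_bounded:
  assumes "\<And>t. t \<in> set ts \<Longrightarrow> is_term L t"
  obtains R where
    "\<And>s t. in_ball r (\<Union>t\<in>set ts. fv_tm t) s \<Longrightarrow> t \<in> set ts \<Longrightarrow> G (eval_tm N s t) < R"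
proof -
  have "\<exists>R. \<forall>s. \<forall>t\<in>set ts. in_ball r (fv_tm t) s \<longrightarrow> G (eval_tm N s t) < R"
    using assms eval_tm_bounded by (intro list_bound) auto
  then show thesis using that by (meson UN_upper in_ball_subset)
qed

definition near :: "real \<Rightarrow> real \<Rightarrow> nat set \<Rightarrow> (nat \<Rightarrow> 'a) \<Rightarrow> (nat \<Rightarrow> 'a) \<Rightarrow> bool" where
  "near \<delta> r V s s' \<longleftrightarrow> in_ball r V s \<and> in_ball r V s' \<and> (\<forall>v\<in>V. D (s v) (s' v) < \<delta>)"

lemma near_mono: "near \<delta> r V s s' \<Longrightarrow> W \<subseteq> V \<Longrightarrow> \<delta> \<le> \<delta>' \<Longrightarrow> near \<delta>' r W s s'"
  by (force simp: near_def in_ball_def)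

lemma near_list_all2:
  assumes "\<And>t. t \<in> set ts \<Longrightarrow> is_term L t"
    and IH: "\<And>t. t \<in> set ts \<Longrightarrow>
      \<exists>\<delta>>0. \<forall>s s'. near \<delta> r (fv_tm t) s s' \<longrightarrow> D (eval_tm N s t) (eval_tm N s' t) < e"
  shows "\<exists>\<delta>>0. \<forall>s s'. near \<delta> r (\<Union>t\<in>set ts. fv_tm t) s s' \<longrightarrow>
    list_all2 (\<lambda>x y. D x y < e) (map (eval_tm N s) ts) (map (eval_tm N s') ts)"
proof -
  \<comment> \<open>The two assignments are packed into one parameter \<open>p\<close> to fit
    \<open>list_radius\<close>.\<close>
  let ?Q = "\<lambda>p t \<delta>. near \<delta> r (fv_tm t) (fst p) (snd p) \<longrightarrow>
    D (eval_tm N (fst p) t) (eval_tm N (snd p) t) < e"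
  have "\<exists>\<delta>>0. \<forall>p. \<forall>t\<in>set ts. ?Q p t \<delta>"
    using IH by (intro list_radius) (fastforce intro: near_mono)+
  then obtain \<delta> where "0 < \<delta>" "\<And>p t. t \<in> set ts \<Longrightarrow> ?Q p t \<delta>" by blast
  then show ?thesis
    by (intro exI[of _ \<delta>]) (force simp: list_all2_map1 list_all2_map2 list_all2_same intro: near_mono)
qed

text \<open>Composition works because the values of the arguments stay in a ball of some radius
  \<open>R\<close>, and the modulus of \<open>f\<close> is used at that radius.\<close>

lemma eval_tm_uniformly_continuous:
  "is_term L t \<Longrightarrow> 0 < e \<Longrightarrow>
    \<exists>\<delta>>0. \<forall>s s'. near \<delta> r (fv_tm t) s s' \<longrightarrow> D (eval_tm N s t) (eval_tm N s' t) < e"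
proof (induction t arbitrary: e)
  case (Var v)
  then show ?case by (auto simp: near_def)
next
  case (Fn f ts)
  have ts: "\<And>t. t \<in> set ts \<Longrightarrow> is_term L t" using Fn.prems by (auto simp: list_all_iff)
  obtain R where
    R: "\<And>s t. in_ball r (\<Union>t\<in>set ts. fv_tm t) s \<Longrightarrow> t \<in> set ts \<Longrightarrow> G (eval_tm N s t) < R"
    using eval_tm_list_bounded[OF ts] by metis
  have f: "f \<in> fun_syms L" using Fn.prems by simp
  obtain \<eta> where \<eta>: "0 < \<eta>"
    "\<And>xs ys. length xs = fun_arity L f \<Longrightarrow> set xs \<subseteq> univ N \<Longrightarrow> set ys \<subseteq> univ N \<Longrightarrow>
      (\<And>x. x \<in> set xs \<union> set ys \<Longrightarrow> G x < R) \<Longrightarrow> list_all2 (\<lambda>x y. D x y < \<eta>) xs ys \<Longrightarrow>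
      D (fun_interp N f xs) (fun_interp N f ys) < e"
    using fun_uniformly_continuous[OF f \<open>0 < e\<close>] by metis
  obtain \<delta> where \<delta>: "0 < \<delta>" "\<And>s s'. near \<delta> r (\<Union>t\<in>set ts. fv_tm t) s s' \<Longrightarrow>
    list_all2 (\<lambda>x y. D x y < \<eta>) (map (eval_tm N s) ts) (map (eval_tm N s') ts)"
    using near_list_all2[OF ts Fn.IH[OF _ ts \<eta>(1)]] by blast
  show ?case
  proof (intro exI[of _ \<delta>] conjI allI impI \<delta>(1))
    fix s s' assume "near \<delta> r (fv_tm (Fn f ts)) s s'"
    then have near: "near \<delta> r (\<Union>t\<in>set ts. fv_tm t) s s'" by simp
    then have "set (map (eval_tm N s) ts) \<subseteq> univ N" "set (map (eval_tm N s') ts) \<subseteq> univ N"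
      by (auto simp: near_def in_ball_def intro!: eval_tm_closed ts)
    moreover have "G x < R" if "x \<in> set (map (eval_tm N s) ts) \<union> set (map (eval_tm N s') ts)" for x
      using that near R by (auto simp: near_def)
    ultimately show "D (eval_tm N s (Fn f ts)) (eval_tm N s' (Fn f ts)) < e"
      using \<eta>(2)[OF _ _ _ _ \<delta>(2)[OF near]] Fn.prems by simp
  qed
qed

text \<open>The size of a formula serves both as the bound of a bounded formula and as the threshold of an
  eventually constant one. It does not increase under \<open>at_inf\<close>, even though \<open>at_inf\<close> may turn
  \<open>\<psi>\<close> monus \<open>\<nu>(x)\<close> into \<open>1\<close> monus \<open>1\<close>.\<close>

definition regular :: "('f, 'p) fm \<Rightarrow> bool" where
  "regular \<phi> \<longleftrightarrow>
    (\<forall>s. s ` fv \<phi> \<subseteq> univ N \<longrightarrow> 0 \<le> E s \<phi>) \<and>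
    (\<forall>s. s ` fv \<phi> \<subseteq> univ N \<longrightarrow> bounded_fm \<phi> \<longrightarrow> E s \<phi> \<le> fm_size \<phi>) \<and>
    (\<forall>s x. s ` insert x (fv \<phi>) \<subseteq> univ N \<longrightarrow> ev_const L x \<phi> \<longrightarrow> fm_size \<phi> \<le> G (s x) \<longrightarrow>
      E s \<phi> = E s (at_inf L x \<phi>)) \<and>
    (\<forall>r. \<exists>B. \<forall>s. in_ball r (fv \<phi>) s \<longrightarrow> E s \<phi> \<le> B)"

lemma regular_nonneg: "regular \<phi> \<Longrightarrow> s ` fv \<phi> \<subseteq> univ N \<Longrightarrow> 0 \<le> E s \<phi>"
  and regular_bounded:
    "regular \<phi> \<Longrightarrow> s ` fv \<phi> \<subseteq> univ N \<Longrightarrow> bounded_fm \<phi> \<Longrightarrow> E s \<phi> \<le> fm_size \<phi>"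
  and regular_threshold: "regular \<phi> \<Longrightarrow> s ` fv \<phi> \<subseteq> univ N \<Longrightarrow> s x \<in> univ N \<Longrightarrow>
    ev_const L x \<phi> \<Longrightarrow> fm_size \<phi> \<le> G (s x) \<Longrightarrow> E s \<phi> = E s (at_inf L x \<phi>)"
  and regular_ball_bound: "regular \<phi> \<Longrightarrow> \<exists>B. \<forall>s. in_ball r (fv \<phi>) s \<longrightarrow> E s \<phi> \<le> B"
  unfolding regular_def by blast+

lemma in_ballE:
  assumes "finite V" "s ` V \<subseteq> univ N"
  obtains r where "in_ball r V s"
proof
  \<comment> \<open>The summand 1 makes the bound strict; the inserted 0 keeps \<open>Max\<close> on
    a nonempty set when \<open>V\<close> is empty.\<close>
  show "in_ball (Max (insert 0 (G ` s ` V)) + 1) V s"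
    unfolding in_ball_def
  proof
    fix v assume "v \<in> V"
    then have "G (s v) \<le> Max (insert 0 (G ` s ` V))"
      using assms(1) by (intro Max_ge) auto
    then show "s v \<in> univ N \<and> G (s v) < Max (insert 0 (G ` s ` V)) + 1"
      using assms(2) \<open>v \<in> V\<close> by auto
  qed
qed

section \<open>The values of a formula under a quantifier\<close>

context
  fixes x :: nat and \<phi> :: "('f, 'p) fm"
  assumes formula: "is_formula L \<phi>" and ev_const: "ev_const L x \<phi>"
    and regular: "regular \<phi>" "regular (at_inf L x \<phi>)"
begin

lemma quant_vals_nonneg:
  assumes "s ` (fv \<phi> - {x}) \<subseteq> univ N" "y \<in> quant_vals s x \<phi>"
  shows "0 \<le> y"
proof -
  have "s ` fv (at_inf L x \<phi>) \<subseteq> univ N" using fv_at_inf[OF ev_const] assms(1) by fast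
  moreover have "s(x := b) ` fv \<phi> \<subseteq> univ N" if "b \<in> univ N" for b
    using assms(1) that by auto
  ultimately show ?thesis
    using regular assms(2) by (auto simp: regular_def quant_vals_def)
qed

lemma quant_vals_bounded_fm:
  assumes "s ` (fv \<phi> - {x}) \<subseteq> univ N" "y \<in> quant_vals s x \<phi>" "bounded_fm \<phi>"
  shows "y \<le> fm_size \<phi>"
proof -
  have "s ` fv (at_inf L x \<phi>) \<subseteq> univ N" using fv_at_inf[OF ev_const] assms(1) by fast
  then have "E s (at_inf L x \<phi>) \<le> fm_size (at_inf L x \<phi>)"
    using regular(2) bounded_at_inf[OF assms(3)] unfolding regular_def by blast
  also have "\<dots> \<le> fm_size \<phi>" by (simp add: fm_size_at_inf)
  finally have "E s (at_inf L x \<phi>) \<le> fm_size \<phi>" .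
  moreover have "E (s(x := b)) \<phi> \<le> fm_size \<phi>" if "b \<in> univ N" for b
  proof -
    have "s(x := b) ` fv \<phi> \<subseteq> univ N" using assms(1) that by auto
    then show ?thesis using regular(1) assms(3) unfolding regular_def by blast
  qed
  ultimately show ?thesis using assms(2) by (auto simp: quant_vals_def)
qed

text \<open>The threshold compares two formulae under the same assignment; the update at
  \<open>x\<close> can then be dropped because \<open>x\<close> is not free in
  \<open>at_inf L x \<phi>\<close>. This is what allows a witness of large gauge to be replaced by
  \<open>\<infinity>\<close>.\<close>

lemma eval_beyond_threshold:
  assumes "s ` (fv \<phi> - {x}) \<subseteq> univ N" "b \<in> univ N" "fm_size \<phi> \<le> G b"
  shows "E (s(x := b)) \<phi> = E s (at_inf L x \<phi>)"
proof -
  have "s(x := b) ` fv \<phi> \<subseteq> univ N" using assms by auto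
  then have "E (s(x := b)) \<phi> = E (s(x := b)) (at_inf L x \<phi>)"
    using regular_threshold[OF regular(1) _ _ ev_const] assms by simp
  also have "\<dots> = E s (at_inf L x \<phi>)"
    using fv_at_inf[OF ev_const] by (intro eval_cong is_formula_at_inf formula) auto
  finally show ?thesis .
qed

text \<open>The point \<open>b\<close> runs through all of the universe, but either it lies beyond
  the threshold and contributes the value at \<open>\<infinity>\<close>, or the updated assignment
  stays in the ball of radius \<open>max r (fm_size \<phi>)\<close>.\<close>

lemma quant_vals_bound:
  obtains B where "\<And>s y. in_ball r (fv \<phi> - {x}) s \<Longrightarrow> y \<in> quant_vals s x \<phi> \<Longrightarrow> y \<le> B"
proof -
  obtain B where B: "\<And>s. in_ball (max r (fm_size \<phi>)) (fv \<phi>) s \<Longrightarrow> E s \<phi> \<le> B"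
    using regular(1) unfolding regular_def by blast
  obtain B' where B': "\<And>s. in_ball r (fv (at_inf L x \<phi>)) s \<Longrightarrow> E s (at_inf L x \<phi>) \<le> B'"
    using regular(2) unfolding regular_def by blast
  show thesis
  proof (rule that)
    fix s y assume s: "in_ball r (fv \<phi> - {x}) s" and y: "y \<in> quant_vals s x \<phi>"
    then have s': "s ` (fv \<phi> - {x}) \<subseteq> univ N" by (auto simp: in_ball_def)
    have inf: "E s (at_inf L x \<phi>) \<le> max B B'"
      using B'[OF in_ball_subset[OF s fv_at_inf[OF ev_const]]] by simp
    have "E (s(x := b)) \<phi> \<le> max B B'" if "b \<in> univ N" for b
    proof (cases "fm_size \<phi> \<le> G b")
      case False
      then have "in_ball (max r (fm_size \<phi>)) (fv \<phi>) (s(x := b))"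
        using s that by (auto simp: in_ball_def less_max_iff_disj)
      then show ?thesis using B by (simp add: le_max_iff_disj)
    qed (use inf eval_beyond_threshold[OF s' that] in simp)
    with inf y show "y \<le> max B B'" by (auto simp: quant_vals_def)
  qed
qed

lemma quant_vals_bdd:
  assumes "s ` (fv \<phi> - {x}) \<subseteq> univ N"
  shows "bdd_above (quant_vals s x \<phi>)" "bdd_below (quant_vals s x \<phi>)"
proof -
  obtain r where "in_ball r (fv \<phi> - {x}) s"
    using in_ballE[OF _ assms] finite_fv by blast
  then show "bdd_above (quant_vals s x \<phi>)"
    using quant_vals_bound[of r] unfolding bdd_above_def by metis
  show "bdd_below (quant_vals s x \<phi>)"
    using quant_vals_nonneg[OF assms] by (auto simp: bdd_below_def)
qed

text \<open>Beyond the threshold for \<open>z\<close> each value is unchanged by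
  \<open>z = \<infinity>\<close>. For the contribution of \<open>x = \<infinity>\<close> the two
  substitutions have to be interchanged, by \<open>at_inf_commute\<close>.\<close>

lemma quant_vals_at_inf:
  assumes "s ` insert z (fv \<phi> - {x}) \<subseteq> univ N" "ev_const L z \<phi>" "z \<noteq> x" "fm_size \<phi> \<le> G (s z)"
  shows "quant_vals s x \<phi> = quant_vals s x (at_inf L z \<phi>)"
proof -
  have "E s (at_inf L x \<phi>) = E s (at_inf L z (at_inf L x \<phi>))"
  proof -
    have "s ` insert z (fv (at_inf L x \<phi>)) \<subseteq> univ N"
      using fv_at_inf[OF ev_const] assms(1) by fast
    moreover have "fm_size (at_inf L x \<phi>) \<le> G (s z)"
      using assms(4) fm_size_at_inf[of L x \<phi>] by linarith
    ultimately show ?thesis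
      using regular(2) ev_const_at_inf[OF assms(2)] unfolding regular_def by blast
  qed
  moreover have "E (s(x := b)) \<phi> = E (s(x := b)) (at_inf L z \<phi>)" if "b \<in> univ N" for b
  proof -
    have "s(x := b) ` insert z (fv \<phi>) \<subseteq> univ N" using assms(1,3) that by auto
    moreover have "fm_size \<phi> \<le> G ((s(x := b)) z)" using assms(3,4) by simp
    ultimately show ?thesis using regular(1) assms(2) unfolding regular_def by blast
  qed
  ultimately show ?thesis by (simp add: quant_vals_def at_inf_commute)
qed

lemma quant_eval_nonneg_bounded:
  assumes "s ` (fv \<phi> - {x}) \<subseteq> univ N"
  shows "0 \<le> Sup (quant_vals s x \<phi>)" "0 \<le> Inf (quant_vals s x \<phi>)"
    and "(\<And>y. y \<in> quant_vals s x \<phi> \<Longrightarrow> y \<le> B) \<Longrightarrow> Sup (quant_vals s x \<phi>) \<le> B"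
    and "(\<And>y. y \<in> quant_vals s x \<phi> \<Longrightarrow> y \<le> B) \<Longrightarrow> Inf (quant_vals s x \<phi>) \<le> B"
proof -
  obtain y where y: "y \<in> quant_vals s x \<phi>" using quant_vals_nonempty by blast
  show "0 \<le> Sup (quant_vals s x \<phi>)"
    using quant_vals_nonneg[OF assms y] cSup_upper[OF y quant_vals_bdd(1)[OF assms]] by linarith
  show "0 \<le> Inf (quant_vals s x \<phi>)"
    using quant_vals_nonneg[OF assms] quant_vals_nonempty by (intro cInf_greatest)
  show "Sup (quant_vals s x \<phi>) \<le> B" if "\<And>y. y \<in> quant_vals s x \<phi> \<Longrightarrow> y \<le> B"
    using that quant_vals_nonempty by (intro cSup_least)
  show "Inf (quant_vals s x \<phi>) \<le> B" if "\<And>y. y \<in> quant_vals s x \<phi> \<Longrightarrow> y \<le> B"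
    using that[OF y] cInf_lower[OF y quant_vals_bdd(2)[OF assms]] by linarith
qed

text \<open>Bound and threshold hold for each element of \<open>quant_vals\<close> already with
  \<open>fm_size \<phi>\<close>, hence also with the larger size of the quantified formula. If
  \<open>z\<close> is the quantified variable, \<open>at_inf\<close> changes nothing.\<close>

lemma regular_quant: "regular (SupF x \<phi>)" "regular (InfF x \<phi>)"
proof -
  have "\<exists>B. \<forall>s. in_ball r (fv \<phi> - {x}) s \<longrightarrow>
      Sup (quant_vals s x \<phi>) \<le> B \<and> Inf (quant_vals s x \<phi>) \<le> B" for r
  proof -
    obtain B where "\<And>s y. in_ball r (fv \<phi> - {x}) s \<Longrightarrow> y \<in> quant_vals s x \<phi> \<Longrightarrow> y \<le> B"
      using quant_vals_bound[of r] by metis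
    then show ?thesis
      by (intro exI[of _ B]) (auto intro!: quant_eval_nonneg_bounded(3,4) simp: in_ball_def)
  qed
  then have bound: "\<exists>B. \<forall>s. in_ball r (fv \<phi> - {x}) s \<longrightarrow> Sup (quant_vals s x \<phi>) \<le> B"
    "\<exists>B. \<forall>s. in_ball r (fv \<phi> - {x}) s \<longrightarrow> Inf (quant_vals s x \<phi>) \<le> B" for r
    by blast+
  have size: "y \<le> real (fm_size \<phi> + 1)"
    if "s ` (fv \<phi> - {x}) \<subseteq> univ N" "y \<in> quant_vals s x \<phi>" "bounded_fm \<phi>" for s y
    using quant_vals_bounded_fm[OF that] by simp
  have inf: "quant_vals s x \<phi> = quant_vals s x (at_inf L z \<phi>)"
    if "s ` insert z (fv \<phi> - {x}) \<subseteq> univ N" "ev_const L z \<phi>" "z \<noteq> x"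
      "real (fm_size \<phi> + 1) \<le> G (s z)" for s z
    using quant_vals_at_inf[OF that(1-3)] that(4) by simp
  show "regular (SupF x \<phi>)"
    unfolding regular_def
  proof (intro conjI allI impI)
    fix s assume s: "s ` fv (SupF x \<phi>) \<subseteq> univ N"
    then show "0 \<le> E s (SupF x \<phi>)"
      unfolding eval_SupF by (auto intro!: quant_eval_nonneg_bounded)
    assume "bounded_fm (SupF x \<phi>)"
    then show "E s (SupF x \<phi>) \<le> fm_size (SupF x \<phi>)"
      unfolding eval_SupF fm_size.simps
      using s by (intro quant_eval_nonneg_bounded(3) size) auto
  next
    fix s z
    assume "s ` insert z (fv (SupF x \<phi>)) \<subseteq> univ N" "ev_const L z (SupF x \<phi>)"
      "fm_size (SupF x \<phi>) \<le> G (s z)"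
    then show "E s (SupF x \<phi>) = E s (at_inf L z (SupF x \<phi>))"
      using inf[of s z] by (cases "z = x") (simp_all add: eval_SupF del: eval.simps)
  qed (use bound in \<open>simp add: eval_SupF del: eval.simps\<close>)
  show "regular (InfF x \<phi>)"
    unfolding regular_def
  proof (intro conjI allI impI)
    fix s assume s: "s ` fv (InfF x \<phi>) \<subseteq> univ N"
    then show "0 \<le> E s (InfF x \<phi>)"
      unfolding eval_InfF by (auto intro!: quant_eval_nonneg_bounded)
    assume "bounded_fm (InfF x \<phi>)"
    then show "E s (InfF x \<phi>) \<le> fm_size (InfF x \<phi>)"
      unfolding eval_InfF fm_size.simps
      using s by (intro quant_eval_nonneg_bounded(4) size) auto
  next
    fix s z
    assume "s ` insert z (fv (InfF x \<phi>)) \<subseteq> univ N" "ev_const L z (InfF x \<phi>)"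
      "fm_size (InfF x \<phi>) \<le> G (s z)"
    then show "E s (InfF x \<phi>) = E s (at_inf L z (InfF x \<phi>))"
      using inf[of s z] by (cases "z = x") (simp_all add: eval_InfF del: eval.simps)
  qed (use bound in \<open>simp add: eval_InfF del: eval.simps\<close>)
qed

end

text \<open>An atom is never bounded and is fixed by \<open>at_inf\<close>, so the work lies in the
  bound on balls: the terms map a ball into a ball, where the modulus of \<open>P\<close> bounds its
  values.\<close>

lemma regular_Atom:
  assumes "is_formula L (Atom P ts)"
  shows "regular (Atom P ts)"
proof -
  have P: "P \<in> pred_syms L" "length ts = pred_arity L P" "\<And>t. t \<in> set ts \<Longrightarrow> is_term L t"
    using assms by auto
  have closed: "set (map (eval_tm N s) ts) \<subseteq> univ N" if "s ` fv (Atom P ts) \<subseteq> univ N" for s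
    using that P(3) by (intro map_eval_tm_closed) auto
  show ?thesis
    unfolding regular_def
  proof (intro conjI allI impI)
    fix s assume "s ` fv (Atom P ts) \<subseteq> univ N"
    then show "0 \<le> E s (Atom P ts)"
      using closed P(1,2) unfolding eval.simps by (intro pred_nonneg) auto
  next
    fix r
    obtain R where
      R: "\<And>s t. in_ball r (\<Union>t\<in>set ts. fv_tm t) s \<Longrightarrow> t \<in> set ts \<Longrightarrow> G (eval_tm N s t) < R"
      using eval_tm_list_bounded[OF P(3)] by metis
    obtain e where e: "0 < e" "R \<le> 1 / e" using modulus_radius[of 1 R] by auto
    have "E s (Atom P ts) \<le> 1 / pred_modulus L P e" if "in_ball r (fv (Atom P ts)) s" for s
    proof -
      have "s ` fv (Atom P ts) \<subseteq> univ N" using that by (auto simp: in_ball_def)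
      moreover have "G x < 1 / e" if "x \<in> set (map (eval_tm N s) ts)" for x
        using that R \<open>in_ball r (fv (Atom P ts)) s\<close> e(2) by fastforce
      ultimately show ?thesis
        using pred_bound[OF P(1) _ closed e(1)] P(2) by simp
    qed
    then show "\<exists>B. \<forall>s. in_ball r (fv (Atom P ts)) s \<longrightarrow> E s (Atom P ts) \<le> B" by blast
  qed auto
qed

lemma regular_Monus:
  assumes "regular \<phi>" "regular \<psi>"
  shows "regular (Monus \<phi> \<psi>)"
  unfolding regular_def
proof (intro conjI allI impI)
  fix s x
  assume s: "s ` insert x (fv (Monus \<phi> \<psi>)) \<subseteq> univ N" and "ev_const L x (Monus \<phi> \<psi>)"
    and size: "fm_size (Monus \<phi> \<psi>) \<le> G (s x)"
  then consider "bounded_fm \<phi>" "\<psi> = gauge_atom L x"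
    | "ev_const L x \<phi>" "ev_const L x \<psi>" "\<psi> \<noteq> gauge_atom L x" by force
  then show "E s (Monus \<phi> \<psi>) = E s (at_inf L x (Monus \<phi> \<psi>))"
  proof cases
    \<comment> \<open>This is where thresholds originate: once \<open>\<nu>(x)\<close> reaches the
      bound of \<open>\<phi>\<close>, the truncated difference is 0, which is the value of
      \<open>Monus One One\<close>.\<close>
    case 1
    then have "E s \<phi> \<le> fm_size \<phi>"
      using s by (auto intro!: regular_bounded assms(1))
    then show ?thesis using 1 size by (simp add: sgauge_def)
  next
    case 2
    then have "E s \<phi> = E s (at_inf L x \<phi>)" "E s \<psi> = E s (at_inf L x \<psi>)"
      using s size by (auto intro!: regular_threshold assms)
    then show ?thesis using 2 by simp
  qed
next
  fix s assume s: "s ` fv (Monus \<phi> \<psi>) \<subseteq> univ N" "bounded_fm (Monus \<phi> \<psi>)"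
  then have "E s \<phi> \<le> fm_size \<phi>" "0 \<le> E s \<psi>"
    by (auto intro!: regular_bounded regular_nonneg assms)
  then show "E s (Monus \<phi> \<psi>) \<le> fm_size (Monus \<phi> \<psi>)" by simp
next
  fix r
  obtain B where B: "\<And>s. in_ball r (fv \<phi>) s \<Longrightarrow> E s \<phi> \<le> B"
    using regular_ball_bound assms by metis
  have "E s (Monus \<phi> \<psi>) \<le> max B 0" if "in_ball r (fv (Monus \<phi> \<psi>)) s" for s
  proof -
    have "0 \<le> E s \<psi>"
      using that by (intro regular_nonneg assms(2)) (auto simp: in_ball_def)
    moreover have "E s \<phi> \<le> B" using that by (auto intro: B in_ball_subset)
    ultimately show ?thesis by simp
  qed
  then show "\<exists>B. \<forall>s. in_ball r (fv (Monus \<phi> \<psi>)) s \<longrightarrow> E s (Monus \<phi> \<psi>) \<le> B" by metis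
qed simp

lemma regular_Plus:
  assumes "regular \<phi>" "regular \<psi>"
  shows "regular (Plus \<phi> \<psi>)"
  unfolding regular_def
proof (intro conjI allI impI)
  fix s x
  assume "s ` insert x (fv (Plus \<phi> \<psi>)) \<subseteq> univ N" "ev_const L x (Plus \<phi> \<psi>)"
    "fm_size (Plus \<phi> \<psi>) \<le> G (s x)"
  then have "E s \<phi> = E s (at_inf L x \<phi>)" "E s \<psi> = E s (at_inf L x \<psi>)"
    by (auto intro!: regular_threshold assms)
  then show "E s (Plus \<phi> \<psi>) = E s (at_inf L x (Plus \<phi> \<psi>))" by simp
next
  fix r
  obtain B where B: "\<And>s. in_ball r (fv \<phi>) s \<Longrightarrow> E s \<phi> \<le> B"
    using regular_ball_bound assms by metis
  obtain B' where B': "\<And>s. in_ball r (fv \<psi>) s \<Longrightarrow> E s \<psi> \<le> B'"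
    using regular_ball_bound assms by metis
  have "E s (Plus \<phi> \<psi>) \<le> B + B'" if "in_ball r (fv (Plus \<phi> \<psi>)) s" for s
    using that by (auto intro!: add_mono B B' intro: in_ball_subset)
  then show "\<exists>B. \<forall>s. in_ball r (fv (Plus \<phi> \<psi>)) s \<longrightarrow> E s (Plus \<phi> \<psi>) \<le> B" by metis
next
  fix s assume s: "s ` fv (Plus \<phi> \<psi>) \<subseteq> univ N"
  then have s': "s ` fv \<phi> \<subseteq> univ N" "s ` fv \<psi> \<subseteq> univ N" by auto
  show "0 \<le> E s (Plus \<phi> \<psi>)"
    using regular_nonneg[OF assms(1) s'(1)] regular_nonneg[OF assms(2) s'(2)] by simp
  show "E s (Plus \<phi> \<psi>) \<le> fm_size (Plus \<phi> \<psi>)" if "bounded_fm (Plus \<phi> \<psi>)"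
    using that regular_bounded[OF assms(1) s'(1)] regular_bounded[OF assms(2) s'(2)] by simp
qed

lemma regular_Half:
  assumes "regular \<phi>"
  shows "regular (Half \<phi>)"
  unfolding regular_def
proof (intro conjI allI impI)
  fix s assume s: "s ` fv (Half \<phi>) \<subseteq> univ N"
  then have "0 \<le> E s \<phi>" using regular_nonneg[OF assms] by simp
  then show "0 \<le> E s (Half \<phi>)" by simp
  assume "bounded_fm (Half \<phi>)"
  with s have "E s \<phi> \<le> fm_size \<phi>" using regular_bounded[OF assms] by simp
  with \<open>0 \<le> E s \<phi>\<close> show "E s (Half \<phi>) \<le> fm_size (Half \<phi>)" by simp
next
  fix s x
  assume "s ` insert x (fv (Half \<phi>)) \<subseteq> univ N" "ev_const L x (Half \<phi>)"
    "fm_size (Half \<phi>) \<le> G (s x)"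
  then have "E s \<phi> = E s (at_inf L x \<phi>)" by (auto intro!: regular_threshold assms)
  then show "E s (Half \<phi>) = E s (at_inf L x (Half \<phi>))" by simp
next
  fix r
  obtain B where B: "\<And>s. in_ball r (fv \<phi>) s \<Longrightarrow> E s \<phi> \<le> B"
    using regular_ball_bound assms by metis
  then show "\<exists>B. \<forall>s. in_ball r (fv (Half \<phi>)) s \<longrightarrow> E s (Half \<phi>) \<le> B"
    by (intro exI[of _ "B / 2"]) auto
qed

lemma regular_One: "regular One"
  by (auto simp: regular_def)

text \<open>Induction on size makes the hypothesis available for \<open>at_inf L x \<psi>\<close> as
  well, which the quantifier case requires.\<close>

lemma regular_formula: "is_formula L \<phi> \<Longrightarrow> regular \<phi>"
proof (induction \<phi> rule: measure_induct_rule[where f = fm_size])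
  case (less \<phi>)
  have at_inf: "regular (at_inf L x \<psi>)" if "fm_size \<psi> < fm_size \<phi>" "is_formula L \<psi>" for x \<psi>
    using that by (intro less.IH le_less_trans[OF fm_size_at_inf] is_formula_at_inf)
  show ?case
  proof (cases \<phi>)
    case (SupF x \<psi>)
    then show ?thesis using less at_inf[of \<psi> x] by (auto intro!: regular_quant)
  next
    case (InfF x \<psi>)
    then show ?thesis using less at_inf[of \<psi> x] by (auto intro!: regular_quant)
  qed (use less in \<open>auto intro!: regular_Atom regular_One regular_Monus regular_Plus regular_Half\<close>)
qed

section \<open>Uniform continuity of formulae on gauge balls\<close>

lemma eval_Atom_uniformly_continuous:
  assumes "is_formula L (Atom P ts)" "0 < e"
  shows "\<exists>\<delta>>0. \<forall>s s'. near \<delta> r (fv (Atom P ts)) s s' \<longrightarrow> \<bar>E s (Atom P ts) - E s' (Atom P ts)\<bar> < e"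
proof -
  have P: "P \<in> pred_syms L" "length ts = pred_arity L P" and ts: "\<And>t. t \<in> set ts \<Longrightarrow> is_term L t"
    using assms by auto
  obtain R where
    R: "\<And>s t. in_ball r (\<Union>t\<in>set ts. fv_tm t) s \<Longrightarrow> t \<in> set ts \<Longrightarrow> G (eval_tm N s t) < R"
    using eval_tm_list_bounded[OF ts] by metis
  obtain \<eta> where \<eta>: "0 < \<eta>"
    "\<And>xs ys. length xs = pred_arity L P \<Longrightarrow> set xs \<subseteq> univ N \<Longrightarrow> set ys \<subseteq> univ N \<Longrightarrow>
      (\<And>x. x \<in> set xs \<union> set ys \<Longrightarrow> G x < R) \<Longrightarrow> list_all2 (\<lambda>x y. D x y < \<eta>) xs ys \<Longrightarrow>
      \<bar>pred_interp N P xs - pred_interp N P ys\<bar> < e"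
    using pred_uniformly_continuous[OF P(1) \<open>0 < e\<close>] by metis
  obtain \<delta> where \<delta>: "0 < \<delta>" "\<And>s s'. near \<delta> r (\<Union>t\<in>set ts. fv_tm t) s s' \<Longrightarrow>
    list_all2 (\<lambda>x y. D x y < \<eta>) (map (eval_tm N s) ts) (map (eval_tm N s') ts)"
    using near_list_all2[OF ts eval_tm_uniformly_continuous[OF ts \<eta>(1)]] by blast
  show ?thesis
  proof (intro exI[of _ \<delta>] conjI allI impI \<delta>(1))
    fix s s' assume "near \<delta> r (fv (Atom P ts)) s s'"
    then have near: "near \<delta> r (\<Union>t\<in>set ts. fv_tm t) s s'" by simp
    then have "set (map (eval_tm N s) ts) \<subseteq> univ N" "set (map (eval_tm N s') ts) \<subseteq> univ N"
      by (auto simp: near_def in_ball_def intro!: eval_tm_closed ts)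
    moreover have "G x < R" if "x \<in> set (map (eval_tm N s) ts) \<union> set (map (eval_tm N s') ts)" for x
      using that near R by (auto simp: near_def)
    ultimately show "\<bar>E s (Atom P ts) - E s' (Atom P ts)\<bar> < e"
      using \<eta>(2)[OF _ _ _ _ \<delta>(2)[OF near]] P by simp
  qed
qed

lemma near_sym: "near \<delta> r V s s' \<Longrightarrow> near \<delta> r V s' s"
  by (auto simp: near_def in_ball_def dist_sym)

text \<open>The two sets of values are within Hausdorff distance \<open>e / 2\<close>. A value at
  \<open>b\<close> is matched by the value at the same \<open>b\<close> if \<open>b\<close> lies
  below the threshold, both updated assignments then being in a ball of radius
  \<open>max r (fm_size \<phi>)\<close>; otherwise it is the value at \<open>\<infinity>\<close> and
  is matched by the other value at \<open>\<infinity>\<close>.\<close>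

lemma quant_uniformly_continuous:
  assumes \<phi>: "is_formula L \<phi>" "ev_const L x \<phi>" and "0 < e"
    and cont: "\<And>r e. 0 < e \<Longrightarrow>
      \<exists>\<delta>>0. \<forall>s s'. near \<delta> r (fv \<phi>) s s' \<longrightarrow> \<bar>E s \<phi> - E s' \<phi>\<bar> < e"
    and cont_inf: "\<And>r e. 0 < e \<Longrightarrow> \<exists>\<delta>>0. \<forall>s s'. near \<delta> r (fv (at_inf L x \<phi>)) s s' \<longrightarrow>
      \<bar>E s (at_inf L x \<phi>) - E s' (at_inf L x \<phi>)\<bar> < e"
  shows "\<exists>\<delta>>0. \<forall>s s'. near \<delta> r (fv \<phi> - {x}) s s' \<longrightarrow>
    \<bar>E s (SupF x \<phi>) - E s' (SupF x \<phi>)\<bar> < e \<and> \<bar>E s (InfF x \<phi>) - E s' (InfF x \<phi>)\<bar> < e"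
proof -
  have e: "0 < e / 2" using \<open>0 < e\<close> by simp
  note regular = regular_formula[OF \<phi>(1)] regular_formula[OF is_formula_at_inf[OF \<phi>(1)]]
  obtain \<delta> where \<delta>: "0 < \<delta>"
    "\<And>s s'. near \<delta> (max r (fm_size \<phi>)) (fv \<phi>) s s' \<Longrightarrow> \<bar>E s \<phi> - E s' \<phi>\<bar> < e / 2"
    using cont[OF e] by metis
  obtain \<delta>' where \<delta>': "0 < \<delta>'"
    "\<And>s s'. near \<delta>' r (fv (at_inf L x \<phi>)) s s' \<Longrightarrow>
      \<bar>E s (at_inf L x \<phi>) - E s' (at_inf L x \<phi>)\<bar> < e / 2"
    using cont_inf[OF e] by metis
  have *: "\<exists>y'\<in>quant_vals s' x \<phi>. \<bar>y - y'\<bar> \<le> e / 2"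
    if near: "near (min \<delta> \<delta>') r (fv \<phi> - {x}) s s'" and y: "y \<in> quant_vals s x \<phi>" for s s' y
  proof -
    have "near \<delta>' r (fv (at_inf L x \<phi>)) s s'"
      using near fv_at_inf[OF \<phi>(2)] by (rule near_mono) simp
    then have inf: "\<bar>E s (at_inf L x \<phi>) - E s' (at_inf L x \<phi>)\<bar> \<le> e / 2"
      using \<delta>'(2) by fastforce
    have s: "s ` (fv \<phi> - {x}) \<subseteq> univ N" using near by (auto simp: near_def in_ball_def)
    from y consider "y = E s (at_inf L x \<phi>)" | b where "b \<in> univ N" "y = E (s(x := b)) \<phi>"
      by (auto simp: quant_vals_def)
    then show ?thesis
    proof cases
      case 1
      with inf show ?thesis by (auto simp: quant_vals_def)
    next
      case 2
      show ?thesis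
      proof (cases "fm_size \<phi> \<le> G b")
        case True
        then show ?thesis
          using inf eval_beyond_threshold[OF \<phi> regular s 2(1)] 2(2) by (auto simp: quant_vals_def)
      next
        case False
        have "near \<delta> (max r (fm_size \<phi>)) (fv \<phi>) (s(x := b)) (s'(x := b))"
          using near 2(1) False \<delta>(1)
          by (auto simp: near_def in_ball_def dist_refl less_max_iff_disj)
        then have "\<bar>y - E (s'(x := b)) \<phi>\<bar> \<le> e / 2" using \<delta>(2) 2(2) by fastforce
        then show ?thesis using 2(1) by (auto simp: quant_vals_def)
      qed
    qed
  qed
  show ?thesis
  proof (intro exI[of _ "min \<delta> \<delta>'"] conjI allI impI)
    show "0 < min \<delta> \<delta>'" using \<delta>(1) \<delta>'(1) by simp
    fix s s' assume near: "near (min \<delta> \<delta>') r (fv \<phi> - {x}) s s'"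
    have **: "\<exists>y\<in>quant_vals s x \<phi>. \<bar>y - y'\<bar> \<le> e / 2" if "y' \<in> quant_vals s' x \<phi>" for y'
      using *[OF near_sym[OF near] that] by (simp add: abs_minus_commute)
    have "s ` (fv \<phi> - {x}) \<subseteq> univ N" "s' ` (fv \<phi> - {x}) \<subseteq> univ N"
      using near by (auto simp: near_def in_ball_def)
    note bdd = quant_vals_bdd[OF \<phi> regular this(1)] quant_vals_bdd[OF \<phi> regular this(2)]
    have "\<bar>E s (SupF x \<phi>) - E s' (SupF x \<phi>)\<bar> \<le> e / 2" unfolding eval_SupF
      using bdd * near ** by (intro Sup_close quant_vals_nonempty) blast+
    then show "\<bar>E s (SupF x \<phi>) - E s' (SupF x \<phi>)\<bar> < e" using e by linarith
    have "\<bar>E s (InfF x \<phi>) - E s' (InfF x \<phi>)\<bar> \<le> e / 2" unfolding eval_InfF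
      using bdd * near ** by (intro Inf_close quant_vals_nonempty) blast+
    then show "\<bar>E s (InfF x \<phi>) - E s' (InfF x \<phi>)\<bar> < e" using e by linarith
  qed
qed

lemma connective_uniformly_continuous:
  assumes "0 < e"
    and "\<And>e. 0 < e \<Longrightarrow> \<exists>\<delta>>0. \<forall>s s'. near \<delta> r (fv \<phi>) s s' \<longrightarrow> \<bar>E s \<phi> - E s' \<phi>\<bar> < e"
    and "\<And>e. 0 < e \<Longrightarrow> \<exists>\<delta>>0. \<forall>s s'. near \<delta> r (fv \<psi>) s s' \<longrightarrow> \<bar>E s \<psi> - E s' \<psi>\<bar> < e"
  shows "\<exists>\<delta>>0. \<forall>s s'. near \<delta> r (fv \<phi> \<union> fv \<psi>) s s' \<longrightarrow>
    \<bar>E s (Monus \<phi> \<psi>) - E s' (Monus \<phi> \<psi>)\<bar> < e \<and> \<bar>E s (Plus \<phi> \<psi>) - E s' (Plus \<phi> \<psi>)\<bar> < e"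
proof -
  have e: "0 < e / 2" using \<open>0 < e\<close> by simp
  obtain \<delta> where \<delta>: "0 < \<delta>" "\<And>s s'. near \<delta> r (fv \<phi>) s s' \<Longrightarrow> \<bar>E s \<phi> - E s' \<phi>\<bar> < e / 2"
    using assms(2)[OF e] by metis
  obtain \<delta>' where \<delta>': "0 < \<delta>'" "\<And>s s'. near \<delta>' r (fv \<psi>) s s' \<Longrightarrow> \<bar>E s \<psi> - E s' \<psi>\<bar> < e / 2"
    using assms(3)[OF e] by metis
  show ?thesis
  proof (intro exI[of _ "min \<delta> \<delta>'"] allI impI conjI)
    show "0 < min \<delta> \<delta>'" using \<delta>(1) \<delta>'(1) by simp
    fix s s' assume near: "near (min \<delta> \<delta>') r (fv \<phi> \<union> fv \<psi>) s s'"
    have "\<bar>E s \<phi> - E s' \<phi>\<bar> < e / 2" "\<bar>E s \<psi> - E s' \<psi>\<bar> < e / 2"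
      by (rule \<delta>(2) \<delta>'(2), rule near_mono[OF near]; simp)+
    then show "\<bar>E s (Monus \<phi> \<psi>) - E s' (Monus \<phi> \<psi>)\<bar> < e" "\<bar>E s (Plus \<phi> \<psi>) - E s' (Plus \<phi> \<psi>)\<bar> < e"
      unfolding eval.simps by linarith+
  qed
qed

text \<open>The radius \<open>r\<close> is generalised in the induction because a quantifier calls
  for the ball enlarged to the threshold.\<close>

lemma eval_uniformly_continuous:
  "is_formula L \<phi> \<Longrightarrow> 0 < e \<Longrightarrow>
    \<exists>\<delta>>0. \<forall>s s'. near \<delta> r (fv \<phi>) s s' \<longrightarrow> \<bar>E s \<phi> - E s' \<phi>\<bar> < e"
proof (induction \<phi> arbitrary: r e rule: measure_induct_rule[where f = fm_size])
  case (less \<phi>)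
  have at_inf: "\<exists>\<delta>>0. \<forall>s s'. near \<delta> r (fv (at_inf L x \<psi>)) s s' \<longrightarrow>
      \<bar>E s (at_inf L x \<psi>) - E s' (at_inf L x \<psi>)\<bar> < e"
    if "fm_size \<psi> < fm_size \<phi>" "is_formula L \<psi>" "0 < e" for x \<psi> r e
    using that by (intro less.IH le_less_trans[OF fm_size_at_inf] is_formula_at_inf)
  show ?case
  proof (cases \<phi>)
    case (Atom P ts)
    then show ?thesis using eval_Atom_uniformly_continuous less.prems by metis
  next
    case One
    then show ?thesis using less.prems by (auto intro: exI[of _ 1])
  next
    case (Monus \<psi> \<xi>)
    then have "\<exists>\<delta>>0. \<forall>s s'. near \<delta> r (fv \<psi> \<union> fv \<xi>) s s' \<longrightarrow>
      \<bar>E s (Monus \<psi> \<xi>) - E s' (Monus \<psi> \<xi>)\<bar> < e \<and> \<bar>E s (Plus \<psi> \<xi>) - E s' (Plus \<psi> \<xi>)\<bar> < e"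
      using less.prems by (intro connective_uniformly_continuous less.IH) auto
    then show ?thesis unfolding Monus fv.simps by blast
  next
    case (Plus \<psi> \<xi>)
    then have "\<exists>\<delta>>0. \<forall>s s'. near \<delta> r (fv \<psi> \<union> fv \<xi>) s s' \<longrightarrow>
      \<bar>E s (Monus \<psi> \<xi>) - E s' (Monus \<psi> \<xi>)\<bar> < e \<and> \<bar>E s (Plus \<psi> \<xi>) - E s' (Plus \<psi> \<xi>)\<bar> < e"
      using less.prems by (intro connective_uniformly_continuous less.IH) auto
    then show ?thesis unfolding Plus fv.simps by blast
  next
    case (Half \<psi>)
    then have "\<exists>\<delta>>0. \<forall>s s'. near \<delta> r (fv \<psi>) s s' \<longrightarrow> \<bar>E s \<psi> - E s' \<psi>\<bar> < e * 2"
      using less.prems by (intro less.IH) auto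
    then show ?thesis unfolding Half fv.simps eval.simps
      by (simp add: diff_divide_distrib[symmetric])
  next
    case (SupF x \<psi>)
    then have "\<exists>\<delta>>0. \<forall>s s'. near \<delta> r (fv \<psi> - {x}) s s' \<longrightarrow>
      \<bar>E s (SupF x \<psi>) - E s' (SupF x \<psi>)\<bar> < e \<and> \<bar>E s (InfF x \<psi>) - E s' (InfF x \<psi>)\<bar> < e"
      using less.prems by (intro quant_uniformly_continuous less.IH at_inf) auto
    then show ?thesis unfolding SupF fv.simps by blast
  next
    case (InfF x \<psi>)
    then have "\<exists>\<delta>>0. \<forall>s s'. near \<delta> r (fv \<psi> - {x}) s s' \<longrightarrow>
      \<bar>E s (SupF x \<psi>) - E s' (SupF x \<psi>)\<bar> < e \<and> \<bar>E s (InfF x \<psi>) - E s' (InfF x \<psi>)\<bar> < e"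
      using less.prems by (intro quant_uniformly_continuous less.IH at_inf) auto
    then show ?thesis unfolding InfF fv.simps by blast
  qed
qed

section \<open>The completion of a pre-structure\<close>

abbreviation "cls t \<equiv> cauchy_rel L N `` {t}"
abbreviation "K \<equiv> completion_struct L N"

lemma cauchy_seqs_closed: "t \<in> cauchy_seqs L N \<Longrightarrow> t n \<in> univ N"
  by (auto simp: cauchy_seqs_def)

lemma const_cauchy: "x \<in> univ N \<Longrightarrow> (\<lambda>_. x) \<in> cauchy_seqs L N"
  by (auto simp: cauchy_seqs_def dist_refl)

lemma equiv_cauchy_rel: "equiv (cauchy_seqs L N) (cauchy_rel L N)"
proof (rule equivI)
  show "cauchy_rel L N \<subseteq> cauchy_seqs L N \<times> cauchy_seqs L N" by (auto simp: cauchy_rel_def)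
  show "refl_on (cauchy_seqs L N) (cauchy_rel L N)"
    by (auto simp: refl_on_def cauchy_rel_def dist_refl cauchy_seqs_closed)
  show "sym (cauchy_rel L N)"
  proof (rule symI)
    fix s t assume "(s, t) \<in> cauchy_rel L N"
    then show "(t, s) \<in> cauchy_rel L N"
      using dist_sym[OF cauchy_seqs_closed cauchy_seqs_closed, of s t] by (simp add: cauchy_rel_def)
  qed
  show "trans (cauchy_rel L N)"
  proof (rule transI)
    fix s t u assume st: "(s, t) \<in> cauchy_rel L N" and tu: "(t, u) \<in> cauchy_rel L N"
    then have *: "s \<in> cauchy_seqs L N" "t \<in> cauchy_seqs L N" "u \<in> cauchy_seqs L N"
      by (auto simp: cauchy_rel_def)
    have "(\<lambda>n. D (s n) (t n) + D (t n) (u n)) \<longlonglongrightarrow> 0 + 0"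
      using st tu by (intro tendsto_add) (auto simp: cauchy_rel_def)
    moreover have "0 \<le> D (s n) (u n)" for n
      using dist_nonneg[OF cauchy_seqs_closed[OF *(1)] cauchy_seqs_closed[OF *(3)]] .
    moreover have "D (s n) (u n) \<le> D (s n) (t n) + D (t n) (u n)" for n
      using dist_triangle[OF cauchy_seqs_closed[OF *(1)] cauchy_seqs_closed[OF *(2)]
          cauchy_seqs_closed[OF *(3)]] .
    ultimately have "(\<lambda>n. D (s n) (u n)) \<longlonglongrightarrow> 0"
      by - (rule tendsto_sandwich[OF _ _ tendsto_const], auto)
    with * show "(s, u) \<in> cauchy_rel L N" by (simp add: cauchy_rel_def)
  qed
qed

lemma seq_rep_cls:
  assumes "t \<in> cauchy_seqs L N"
  shows "(t, seq_rep (cls t)) \<in> cauchy_rel L N"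
proof -
  have "t \<in> cls t" using equiv_cauchy_rel assms by (rule equiv_class_self)
  then have "seq_rep (cls t) \<in> cls t" unfolding seq_rep_def by (rule someI[of "\<lambda>s. s \<in> cls t"])
  then show ?thesis by simp
qed

text \<open>The gauge is 1-Lipschitz, so it maps Cauchy sequences to Cauchy sequences of reals.
  Hence a Cauchy sequence stays in one gauge ball, where the symbols are uniformly
  continuous.\<close>

lemma cauchy_gauge_bounded:
  assumes "t \<in> cauchy_seqs L N"
  shows "\<exists>R. \<forall>n. G (t n) < R"
proof -
  have "Cauchy (\<lambda>n. G (t n))"
  proof (rule CauchyI)
    fix e :: real assume "0 < e"
    then obtain k where k: "\<forall>m\<ge>k. \<forall>n\<ge>k. D (t m) (t n) < e"
      using assms unfolding cauchy_seqs_def by blast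
    have "norm (G (t m) - G (t n)) < e" if "m \<ge> k" "n \<ge> k" for m n
      using gauge_lipschitz[OF cauchy_seqs_closed[OF assms] cauchy_seqs_closed[OF assms], of m n]
        k that by (simp add: le_less_trans)
    then show "\<exists>k. \<forall>m\<ge>k. \<forall>n\<ge>k. norm (G (t m) - G (t n)) < e" by blast
  qed
  then have "Bseq (\<lambda>n. G (t n))" by (rule Cauchy_Bseq)
  then obtain B where "\<And>n. \<bar>G (t n)\<bar> \<le> B" by (auto simp: Bseq_def)
  then have "\<forall>n. G (t n) < B + 1" by (smt (verit))
  then show ?thesis ..
qed

lemma cauchy_list_gauge_bounded:
  assumes "set ts \<subseteq> cauchy_seqs L N"
  obtains R where "\<And>n x. x \<in> set (map (\<lambda>t. t n) ts) \<Longrightarrow> G x < R"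
proof -
  have "\<exists>R. \<forall>n. \<forall>t\<in>set ts. True \<longrightarrow> G (t n) < R"
    using assms cauchy_gauge_bounded by (intro list_bound) auto
  then show thesis using that by auto
qed

lemma cauchy_list:
  assumes "set ts \<subseteq> cauchy_seqs L N" "0 < e"
  shows "\<exists>k. \<forall>m\<ge>k. \<forall>n\<ge>k. list_all2 (\<lambda>x y. D x y < e) (map (\<lambda>t. t m) ts) (map (\<lambda>t. t n) ts)"
  using assms(1)
proof (induction ts)
  case (Cons t ts)
  then obtain k where
    k: "\<forall>m\<ge>k. \<forall>n\<ge>k. list_all2 (\<lambda>x y. D x y < e) (map (\<lambda>t. t m) ts) (map (\<lambda>t. t n) ts)"
    by auto
  obtain k' where "\<forall>m\<ge>k'. \<forall>n\<ge>k'. D (t m) (t n) < e"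
    using Cons.prems assms(2) by (auto simp: cauchy_seqs_def)
  with k show ?case by (intro exI[of _ "max k k'"]) auto
qed simp

lemma equivalent_list:
  assumes "list_all2 (\<lambda>s t. (s, t) \<in> cauchy_rel L N) ss ts" "0 < e"
  shows "\<forall>\<^sub>F n in sequentially. list_all2 (\<lambda>x y. D x y < e) (map (\<lambda>t. t n) ss) (map (\<lambda>t. t n) ts)"
  using assms(1)
proof (induction rule: list_all2_induct)
  case (Cons s ss t ts)
  then have "\<forall>\<^sub>F n in sequentially. D (s n) (t n) < e"
    using assms(2) by (auto simp: cauchy_rel_def dest: order_tendstoD)
  with Cons.IH show ?case by eventually_elim simp
qed simp

lemma list_all2_cauchy_rel:
  assumes "list_all2 (\<lambda>s t. (s, t) \<in> cauchy_rel L N) ss ts"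
  shows "length ss = length ts" "set ss \<subseteq> cauchy_seqs L N" "set ts \<subseteq> cauchy_seqs L N"
  using assms by (induction rule: list_all2_induct) (auto simp: cauchy_rel_def)

lemma cauchy_list_closed: "set ts \<subseteq> cauchy_seqs L N \<Longrightarrow> set (map (\<lambda>t. t n) ts) \<subseteq> univ N"
  using cauchy_seqs_closed by auto

text \<open>All terms of the sequences in \<open>ss\<close> and \<open>ts\<close> lie in a common
  gauge ball, on which \<open>P\<close> is uniformly continuous. Together with convergence this
  shows that extension along representatives is well defined.\<close>

lemma pred_equivalent:
  assumes P: "P \<in> pred_syms L" "length ss = pred_arity L P"
    and rel: "list_all2 (\<lambda>s t. (s, t) \<in> cauchy_rel L N) ss ts"
  shows "(\<lambda>n. pred_interp N P (map (\<lambda>t. t n) ss) - pred_interp N P (map (\<lambda>t. t n) ts)) \<longlonglongrightarrow> 0"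
proof (rule tendstoI)
  fix e :: real assume "0 < e"
  note ss = list_all2_cauchy_rel[OF rel]
  obtain R where R: "\<And>n x. x \<in> set (map (\<lambda>t. t n) ss) \<Longrightarrow> G x < R"
    using cauchy_list_gauge_bounded[OF ss(2)] by metis
  obtain R' where R': "\<And>n x. x \<in> set (map (\<lambda>t. t n) ts) \<Longrightarrow> G x < R'"
    using cauchy_list_gauge_bounded[OF ss(3)] by metis
  obtain \<delta> where \<delta>: "0 < \<delta>"
    "\<And>xs ys. length xs = pred_arity L P \<Longrightarrow> set xs \<subseteq> univ N \<Longrightarrow> set ys \<subseteq> univ N \<Longrightarrow>
      (\<And>x. x \<in> set xs \<union> set ys \<Longrightarrow> G x < max R R') \<Longrightarrow> list_all2 (\<lambda>x y. D x y < \<delta>) xs ys \<Longrightarrow>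
      \<bar>pred_interp N P xs - pred_interp N P ys\<bar> < e"
    using pred_uniformly_continuous[OF P(1) \<open>0 < e\<close>] by metis
  have bound: "G x < max R R'" if "x \<in> set (map (\<lambda>t. t n) ss) \<union> set (map (\<lambda>t. t n) ts)" for x n
    using that R R' unfolding less_max_iff_disj by blast
  show "\<forall>\<^sub>F n in sequentially.
      dist (pred_interp N P (map (\<lambda>t. t n) ss) - pred_interp N P (map (\<lambda>t. t n) ts)) 0 < e"
    using equivalent_list[OF rel \<delta>(1)]
  proof eventually_elim
    case (elim n)
    then show ?case
      using \<delta>(2)[OF _ cauchy_list_closed[OF ss(2)] cauchy_list_closed[OF ss(3)] bound] P(2)
      by (simp add: dist_real_def)
  qed
qed

lemma pred_convergent:
  assumes P: "P \<in> pred_syms L" "length ts = pred_arity L P" and ts: "set ts \<subseteq> cauchy_seqs L N"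
  shows "convergent (\<lambda>n. pred_interp N P (map (\<lambda>t. t n) ts))"
proof (intro Cauchy_convergent CauchyI)
  fix e :: real assume "0 < e"
  obtain R where R: "\<And>n x. x \<in> set (map (\<lambda>t. t n) ts) \<Longrightarrow> G x < R"
    using cauchy_list_gauge_bounded[OF ts] by metis
  obtain \<delta> where \<delta>: "0 < \<delta>"
    "\<And>xs ys. length xs = pred_arity L P \<Longrightarrow> set xs \<subseteq> univ N \<Longrightarrow> set ys \<subseteq> univ N \<Longrightarrow>
      (\<And>x. x \<in> set xs \<union> set ys \<Longrightarrow> G x < R) \<Longrightarrow> list_all2 (\<lambda>x y. D x y < \<delta>) xs ys \<Longrightarrow>
      \<bar>pred_interp N P xs - pred_interp N P ys\<bar> < e"
    using pred_uniformly_continuous[OF P(1) \<open>0 < e\<close>] by metis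
  obtain k where
    "\<forall>m\<ge>k. \<forall>n\<ge>k. list_all2 (\<lambda>x y. D x y < \<delta>) (map (\<lambda>t. t m) ts) (map (\<lambda>t. t n) ts)"
    using cauchy_list[OF ts \<delta>(1)] by blast
  moreover have "G x < R" if "x \<in> set (map (\<lambda>t. t m) ts) \<union> set (map (\<lambda>t. t n) ts)" for x m n
    using that R by blast
  ultimately show "\<exists>k. \<forall>m\<ge>k. \<forall>n\<ge>k.
      norm (pred_interp N P (map (\<lambda>t. t m) ts) - pred_interp N P (map (\<lambda>t. t n) ts)) < e"
    using \<delta>(2)[OF _ cauchy_list_closed[OF ts] cauchy_list_closed[OF ts]] P(2)
    by (intro exI[of _ k]) simp
qed

lemma fun_cauchy:
  assumes f: "f \<in> fun_syms L" "length ts = fun_arity L f" and ts: "set ts \<subseteq> cauchy_seqs L N"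
  shows "(\<lambda>n. fun_interp N f (map (\<lambda>t. t n) ts)) \<in> cauchy_seqs L N"
  unfolding cauchy_seqs_def
proof (intro CollectI conjI allI impI)
  show "range (\<lambda>n. fun_interp N f (map (\<lambda>t. t n) ts)) \<subseteq> univ N"
    using fun_closed[OF f(1) _ cauchy_list_closed[OF ts]] f(2) by auto
  fix e :: real assume "0 < e"
  obtain R where R: "\<And>n x. x \<in> set (map (\<lambda>t. t n) ts) \<Longrightarrow> G x < R"
    using cauchy_list_gauge_bounded[OF ts] by metis
  obtain \<delta> where \<delta>: "0 < \<delta>"
    "\<And>xs ys. length xs = fun_arity L f \<Longrightarrow> set xs \<subseteq> univ N \<Longrightarrow> set ys \<subseteq> univ N \<Longrightarrow>
      (\<And>x. x \<in> set xs \<union> set ys \<Longrightarrow> G x < R) \<Longrightarrow> list_all2 (\<lambda>x y. D x y < \<delta>) xs ys \<Longrightarrow>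
      D (fun_interp N f xs) (fun_interp N f ys) < e"
    using fun_uniformly_continuous[OF f(1) \<open>0 < e\<close>] by metis
  obtain k where
    "\<forall>m\<ge>k. \<forall>n\<ge>k. list_all2 (\<lambda>x y. D x y < \<delta>) (map (\<lambda>t. t m) ts) (map (\<lambda>t. t n) ts)"
    using cauchy_list[OF ts \<delta>(1)] by blast
  moreover have "G x < R" if "x \<in> set (map (\<lambda>t. t m) ts) \<union> set (map (\<lambda>t. t n) ts)" for x m n
    using that R by blast
  ultimately show "\<exists>k. \<forall>m\<ge>k. \<forall>n\<ge>k.
      D (fun_interp N f (map (\<lambda>t. t m) ts)) (fun_interp N f (map (\<lambda>t. t n) ts)) < e"
    using \<delta>(2)[OF _ cauchy_list_closed[OF ts] cauchy_list_closed[OF ts]] f(2)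
    by (intro exI[of _ k]) simp
qed

lemma fun_equivalent:
  assumes f: "f \<in> fun_syms L" "length ss = fun_arity L f"
    and rel: "list_all2 (\<lambda>s t. (s, t) \<in> cauchy_rel L N) ss ts"
  shows "(\<lambda>n. fun_interp N f (map (\<lambda>t. t n) ss), \<lambda>n. fun_interp N f (map (\<lambda>t. t n) ts))
    \<in> cauchy_rel L N"
proof -
  note ss = list_all2_cauchy_rel[OF rel]
  have cauchy: "(\<lambda>n. fun_interp N f (map (\<lambda>t. t n) ss)) \<in> cauchy_seqs L N"
    "(\<lambda>n. fun_interp N f (map (\<lambda>t. t n) ts)) \<in> cauchy_seqs L N"
    using f ss by (auto intro!: fun_cauchy)
  have "(\<lambda>n. D (fun_interp N f (map (\<lambda>t. t n) ss)) (fun_interp N f (map (\<lambda>t. t n) ts))) \<longlonglongrightarrow> 0"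
  proof (rule tendstoI)
    fix e :: real assume "0 < e"
    obtain R where R: "\<And>n x. x \<in> set (map (\<lambda>t. t n) ss) \<Longrightarrow> G x < R"
      using cauchy_list_gauge_bounded[OF ss(2)] by metis
    obtain R' where R': "\<And>n x. x \<in> set (map (\<lambda>t. t n) ts) \<Longrightarrow> G x < R'"
      using cauchy_list_gauge_bounded[OF ss(3)] by metis
    obtain \<delta> where \<delta>: "0 < \<delta>"
      "\<And>xs ys. length xs = fun_arity L f \<Longrightarrow> set xs \<subseteq> univ N \<Longrightarrow> set ys \<subseteq> univ N \<Longrightarrow>
        (\<And>x. x \<in> set xs \<union> set ys \<Longrightarrow> G x < max R R') \<Longrightarrow> list_all2 (\<lambda>x y. D x y < \<delta>) xs ys \<Longrightarrow>
        D (fun_interp N f xs) (fun_interp N f ys) < e"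
      using fun_uniformly_continuous[OF f(1) \<open>0 < e\<close>] by metis
    have bound: "G x < max R R'" if "x \<in> set (map (\<lambda>t. t n) ss) \<union> set (map (\<lambda>t. t n) ts)" for x n
      using that R R' unfolding less_max_iff_disj by blast
    show "\<forall>\<^sub>F n in sequentially.
        dist (D (fun_interp N f (map (\<lambda>t. t n) ss)) (fun_interp N f (map (\<lambda>t. t n) ts))) 0 < e"
      using equivalent_list[OF rel \<delta>(1)]
    proof eventually_elim
      case (elim n)
      have "D (fun_interp N f (map (\<lambda>t. t n) ss)) (fun_interp N f (map (\<lambda>t. t n) ts)) < e"
        using \<delta>(2)[OF _ cauchy_list_closed[OF ss(2)] cauchy_list_closed[OF ss(3)] bound elim] f(2)
        by simp
      then show ?case
        using dist_nonneg[OF cauchy_seqs_closed[OF cauchy(1)] cauchy_seqs_closed[OF cauchy(2)], of n n]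
        by (simp add: dist_real_def)
    qed
  qed
  with cauchy show ?thesis by (simp add: cauchy_rel_def)
qed

lemma list_all2_seq_rep:
  assumes "set ts \<subseteq> cauchy_seqs L N"
  shows "list_all2 (\<lambda>s t. (s, t) \<in> cauchy_rel L N) ts (map (\<lambda>t. seq_rep (cls t)) ts)"
  using assms by (induction ts) (auto intro: seq_rep_cls)

lemma completion_univ: "univ K = cls ` cauchy_seqs L N"
  by (auto simp: completion_struct_def quotient_def)

text \<open>The completion is defined along the representatives chosen by \<open>seq_rep\<close>.
  Other representatives change the sequence of values only by a null sequence, so the limit may be
  computed along \<open>ts\<close> itself.\<close>

lemma completion_pred:
  assumes P: "P \<in> pred_syms L" "length ts = pred_arity L P" and ts: "set ts \<subseteq> cauchy_seqs L N"
  shows "(\<lambda>n. pred_interp N P (map (\<lambda>t. t n) ts)) \<longlonglongrightarrow> pred_interp K P (map cls ts)"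
proof -
  let ?rs = "map (\<lambda>t. seq_rep (cls t)) ts"
  have "set ?rs \<subseteq> cauchy_seqs L N" using list_all2_cauchy_rel[OF list_all2_seq_rep[OF ts]] by blast
  then have "convergent (\<lambda>n. pred_interp N P (map (\<lambda>t. t n) ?rs))"
    using P by (intro pred_convergent) auto
  then have "(\<lambda>n. pred_interp N P (map (\<lambda>t. t n) ?rs)) \<longlonglongrightarrow> pred_interp K P (map cls ts)"
    by (simp add: completion_struct_def convergent_LIMSEQ_iff comp_def)
  from tendsto_add[OF pred_equivalent[OF P list_all2_seq_rep[OF ts]] this]
  show ?thesis by simp
qed

lemma completion_fun:
  assumes "f \<in> fun_syms L" "length ts = fun_arity L f" "set ts \<subseteq> cauchy_seqs L N"
  shows "fun_interp K f (map cls ts) = cls (\<lambda>n. fun_interp N f (map (\<lambda>t. t n) ts))"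
  using equiv_class_eq[OF equiv_cauchy_rel fun_equivalent[OF assms(1,2) list_all2_seq_rep[OF assms(3)]]]
  by (simp add: completion_struct_def comp_def)

end

text \<open>\<open>K\<close> is a limit of the \<open>N i\<close> along \<open>F\<close>, its points
  being named by threads \<open>a\<close> in \<open>C\<close> through \<open>q\<close>. A strict
  hypothesis of a modulus that holds in \<open>K\<close> holds eventually in \<open>N i\<close>, and
  the non-strict conclusion there returns to \<open>K\<close> in the limit. It serves for the
  completion, with \<open>F\<close> the sequences' filter, and for the pre-ultraproduct, with
  \<open>F\<close> the ultrafilter.\<close>

lemma pre_structure_limit:
  fixes N :: "'i \<Rightarrow> ('a, 'f, 'p) struct" and K :: "('b, 'f, 'p) struct" and q :: "('i \<Rightarrow> 'a) \<Rightarrow> 'b"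
  assumes "F \<noteq> bot" and L: "is_signature L" and N: "\<And>i. pre_structure L (N i)"
    and univ: "univ K = q ` C" and C: "\<And>a. a \<in> C \<Longrightarrow> \<forall>\<^sub>F i in F. a i \<in> univ (N i)"
    and pred: "\<And>P as. P \<in> pred_syms L \<Longrightarrow> length as = pred_arity L P \<Longrightarrow> set as \<subseteq> C \<Longrightarrow>
      ((\<lambda>i. pred_interp (N i) P (map (\<lambda>a. a i) as)) \<longlongrightarrow> pred_interp K P (map q as)) F"
    and func: "\<And>f as. f \<in> fun_syms L \<Longrightarrow> length as = fun_arity L f \<Longrightarrow> set as \<subseteq> C \<Longrightarrow>
      \<exists>b\<in>C. fun_interp K f (map q as) = q b \<and>
        (\<forall>\<^sub>F i in F. b i = fun_interp (N i) f (map (\<lambda>a. a i) as))"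
  shows "pre_structure L K"
proof -
  interpret N: pre_structure L "N i" for i by (rule N)
  have dist: "((\<lambda>i. sdist L (N i) (a i) (b i)) \<longlongrightarrow> sdist L K (q a) (q b)) F"
    if "a \<in> C" "b \<in> C" for a b
    using that L pred[of "dist_sym L" "[a, b]"] by (simp add: is_signature_def sdist_def)
  have gauge: "((\<lambda>i. sgauge L (N i) (a i)) \<longlongrightarrow> sgauge L K (q a)) F" if "a \<in> C" for a
    using that L pred[of "gauge_sym L" "[a]"] by (simp add: is_signature_def sgauge_def)
  have reps: "\<exists>as. xs = map q as \<and> set as \<subseteq> C" if "set xs \<subseteq> univ K" for xs
  proof -
    have "xs \<in> map q ` lists C" using that univ by (simp flip: lists_image add: in_lists_conv_set subset_iff)
    then show ?thesis by (auto simp: in_lists_conv_set)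
  qed
  have closed: "\<forall>\<^sub>F i in F. set (map (\<lambda>a. a i) as) \<subseteq> univ (N i)" if "set as \<subseteq> C" for as
  proof -
    have "\<forall>a\<in>set as. \<forall>\<^sub>F i in F. a i \<in> univ (N i)" using that C by blast
    then show ?thesis by (simp add: image_subset_iff eventually_ball_finite)
  qed
  \<comment> \<open>Strict bounds on limits hold eventually along \<open>F\<close>, simultaneously
    for the finitely many entries of a list; likewise for distances below.\<close>
  have small: "\<forall>\<^sub>F i in F. \<forall>x\<in>set (map (\<lambda>a. a i) as). sgauge L (N i) x < r"
    if "set as \<subseteq> C" "\<And>x. x \<in> set (map q as) \<Longrightarrow> sgauge L K x < r" for as r
  proof -
    have "\<forall>a\<in>set as. \<forall>\<^sub>F i in F. sgauge L (N i) (a i) < r"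
      using that by (auto intro!: order_tendstoD(2)[OF gauge])
    then show ?thesis by (simp add: eventually_ball_finite)
  qed
  have near: "\<forall>\<^sub>F i in F. list_all2 (\<lambda>x y. sdist L (N i) x y < e) (map (\<lambda>a. a i) as) (map (\<lambda>a. a i) bs)"
    if "list_all2 (\<lambda>x y. sdist L K x y < e) (map q as) (map q bs)" "set as \<subseteq> C" "set bs \<subseteq> C" for as bs e
  proof -
    have "list_all2 (\<lambda>a b. sdist L K (q a) (q b) < e) as bs"
      using that(1) by (simp add: list_all2_map1 list_all2_map2)
    then show ?thesis using that(2,3)
    proof (induction rule: list_all2_induct)
      case (Cons a as b bs)
      then have "\<forall>\<^sub>F i in F. sdist L (N i) (a i) (b i) < e"
        by (auto intro: order_tendstoD(2)[OF dist])
      with Cons show ?case by (auto elim: eventually_elim2)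
    qed simp
  qed
  show ?thesis
  proof
    show "is_signature L" by (rule L)
  next
    fix x assume "x \<in> univ K"
    then obtain a where a: "a \<in> C" "x = q a" using univ by blast
    have "((\<lambda>i. sdist L (N i) (a i) (a i)) \<longlongrightarrow> 0) F"
      using C[OF a(1)] by (intro tendsto_eventually) (auto elim: eventually_mono simp: N.dist_refl)
    then show "sdist L K x x = 0" using dist[OF a(1) a(1)] a(2) \<open>F \<noteq> bot\<close> tendsto_unique by blast
  next
    fix x y assume "x \<in> univ K" "y \<in> univ K"
    then obtain a b where ab: "a \<in> C" "b \<in> C" "x = q a" "y = q b" using univ by blast
    have "\<forall>\<^sub>F i in F. sdist L (N i) (b i) (a i) = sdist L (N i) (a i) (b i)"
      using C[OF ab(1)] C[OF ab(2)] by eventually_elim (simp add: N.dist_sym)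
    from tendsto_cong[OF this] show "sdist L K x y = sdist L K y x"
      using dist[OF ab(1,2)] dist[OF ab(2,1)] ab(3,4) \<open>F \<noteq> bot\<close> tendsto_unique by blast
    have "\<forall>\<^sub>F i in F. \<bar>sgauge L (N i) (a i) - sgauge L (N i) (b i)\<bar> \<le> sdist L (N i) (a i) (b i)"
      using C[OF ab(1)] C[OF ab(2)] by eventually_elim (simp add: N.gauge_lipschitz)
    then show "\<bar>sgauge L K x - sgauge L K y\<bar> \<le> sdist L K x y"
      unfolding ab(3,4) using \<open>F \<noteq> bot\<close> ab(1,2)
      by (intro tendsto_le[OF _ dist tendsto_rabs[OF tendsto_diff[OF gauge gauge]]])
  next
    fix x y z assume "x \<in> univ K" "y \<in> univ K" "z \<in> univ K"
    then obtain a b c where abc: "a \<in> C" "b \<in> C" "c \<in> C" "x = q a" "y = q b" "z = q c"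
      using univ by blast
    have "\<forall>\<^sub>F i in F. sdist L (N i) (a i) (c i) \<le> sdist L (N i) (a i) (b i) + sdist L (N i) (b i) (c i)"
      using C[OF abc(1)] C[OF abc(2)] C[OF abc(3)] by eventually_elim (simp add: N.dist_triangle)
    then show "sdist L K x z \<le> sdist L K x y + sdist L K y z"
      unfolding abc(4-6) using \<open>F \<noteq> bot\<close> abc(1-3)
      by (intro tendsto_le[OF _ tendsto_add[OF dist dist] dist])
  next
    fix f xs assume f: "f \<in> fun_syms L" "length xs = fun_arity L f" "set xs \<subseteq> univ K"
    then obtain as where "xs = map q as" "set as \<subseteq> C" using reps by blast
    then show "fun_interp K f xs \<in> univ K" using func[OF f(1), of as] f(2) univ by auto
  next
    fix P xs assume P: "P \<in> pred_syms L" "length xs = pred_arity L P" "set xs \<subseteq> univ K"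
    then obtain as where as: "xs = map q as" "set as \<subseteq> C" using reps by blast
    have "\<forall>\<^sub>F i in F. 0 \<le> pred_interp (N i) P (map (\<lambda>a. a i) as)"
      using closed[OF as(2)] by eventually_elim (use P as in \<open>auto intro!: N.pred_nonneg\<close>)
    then show "0 \<le> pred_interp K P xs"
      using pred[OF P(1) _ as(2)] P(2) as(1) \<open>F \<noteq> bot\<close> by (auto intro: tendsto_lowerbound)
  next
    fix f xs ys e
    assume f: "f \<in> fun_syms L" "length xs = fun_arity L f" "set xs \<subseteq> univ K" "set ys \<subseteq> univ K"
      and e: "0 < e" and gauge_xs: "\<And>x. x \<in> set xs \<union> set ys \<Longrightarrow> sgauge L K x < 1 / e"
      and dist_xs: "list_all2 (\<lambda>x y. sdist L K x y < fun_modulus L f e) xs ys"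
    obtain as where as: "xs = map q as" "set as \<subseteq> C" using reps[OF f(3)] by blast
    obtain bs where bs: "ys = map q bs" "set bs \<subseteq> C" using reps[OF f(4)] by blast
    have len: "length as = fun_arity L f" "length bs = fun_arity L f"
      using f(2) list_all2_lengthD[OF dist_xs] as bs by auto
    obtain c where c: "c \<in> C" "fun_interp K f xs = q c"
        "\<forall>\<^sub>F i in F. c i = fun_interp (N i) f (map (\<lambda>a. a i) as)"
      using func[OF f(1) len(1) as(2)] as(1) by blast
    obtain d where d: "d \<in> C" "fun_interp K f ys = q d"
        "\<forall>\<^sub>F i in F. d i = fun_interp (N i) f (map (\<lambda>a. a i) bs)"
      using func[OF f(1) len(2) bs(2)] bs(1) by blast
    have "\<forall>\<^sub>F i in F. \<forall>x\<in>set (map (\<lambda>a. a i) (as @ bs)). sgauge L (N i) x < 1 / e"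
      using as bs gauge_xs by (intro small) auto
    then have "\<forall>\<^sub>F i in F. sdist L (N i) (c i) (d i) \<le> e \<and> sgauge L (N i) (c i) \<le> 1 / fun_modulus L f e"
      using closed[OF as(2)] closed[OF bs(2)] near[OF dist_xs[unfolded as(1) bs(1)] as(2) bs(2)] c(3) d(3)
    proof eventually_elim
      case (elim i)
      show ?case
        unfolding elim(5,6) using elim(1) len by (intro N.fun_respects f e elim(2-4)) auto
    qed
    then have "\<forall>\<^sub>F i in F. sdist L (N i) (c i) (d i) \<le> e"
      "\<forall>\<^sub>F i in F. sgauge L (N i) (c i) \<le> 1 / fun_modulus L f e" by (auto elim: eventually_mono)
    then show "sdist L K (fun_interp K f xs) (fun_interp K f ys) \<le> e \<and>
        sgauge L K (fun_interp K f xs) \<le> 1 / fun_modulus L f e"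
      using tendsto_upperbound[OF dist[OF c(1) d(1)]] tendsto_upperbound[OF gauge[OF c(1)]]
        \<open>F \<noteq> bot\<close> c(2) d(2) by auto
  next
    fix P xs ys e
    assume P: "P \<in> pred_syms L" "length xs = pred_arity L P" "set xs \<subseteq> univ K" "set ys \<subseteq> univ K"
      and e: "0 < e" and gauge_xs: "\<And>x. x \<in> set xs \<union> set ys \<Longrightarrow> sgauge L K x < 1 / e"
      and dist_xs: "list_all2 (\<lambda>x y. sdist L K x y < pred_modulus L P e) xs ys"
    obtain as where as: "xs = map q as" "set as \<subseteq> C" using reps[OF P(3)] by blast
    obtain bs where bs: "ys = map q bs" "set bs \<subseteq> C" using reps[OF P(4)] by blast
    have len: "length as = pred_arity L P" "length bs = pred_arity L P"
      using P(2) list_all2_lengthD[OF dist_xs] as bs by auto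
    let ?p = "\<lambda>i as. pred_interp (N i) P (map (\<lambda>a. a i) as)"
    have "\<forall>\<^sub>F i in F. \<forall>x\<in>set (map (\<lambda>a. a i) (as @ bs)). sgauge L (N i) x < 1 / e"
      using as bs gauge_xs by (intro small) auto
    then have "\<forall>\<^sub>F i in F. \<bar>?p i as - ?p i bs\<bar> \<le> e \<and> ?p i as \<le> 1 / pred_modulus L P e"
      using closed[OF as(2)] closed[OF bs(2)] near[OF dist_xs[unfolded as(1) bs(1)] as(2) bs(2)]
    proof eventually_elim
      case (elim i)
      show ?case using elim(1) len by (intro N.pred_respects P e elim(2-4)) auto
    qed
    then have "\<forall>\<^sub>F i in F. \<bar>?p i as - ?p i bs\<bar> \<le> e" "\<forall>\<^sub>F i in F. ?p i as \<le> 1 / pred_modulus L P e"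
      by (auto elim: eventually_mono)
    then show "\<bar>pred_interp K P xs - pred_interp K P ys\<bar> \<le> e \<and>
        pred_interp K P xs \<le> 1 / pred_modulus L P e"
      using tendsto_upperbound[OF tendsto_rabs[OF tendsto_diff[OF pred[OF P(1) len(1) as(2)]
          pred[OF P(1) len(2) bs(2)]]]]
        tendsto_upperbound[OF pred[OF P(1) len(1) as(2)]] \<open>F \<noteq> bot\<close> as(1) bs(1) by auto
  qed
qed

section \<open>The dense embedding into the completion\<close>

context pre_structure
begin

text \<open>The completion is the limit of the constant family \<open>N\<close>, with the Cauchy
  sequences as threads.\<close>

lemma pre_structure_completion: "pre_structure L K"
proof (rule pre_structure_limit[where F = sequentially and N = "\<lambda>_. N" and q = cls and C = "cauchy_seqs L N"])
  show "pre_structure L N" by (rule pre_structure_axioms)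
qed (auto simp: signature completion_univ cauchy_seqs_closed completion_pred completion_fun intro: fun_cauchy)

abbreviation "emb \<equiv> completion_embed L N"

lemma map_emb: "map emb xs = map cls (map (\<lambda>x _. x) xs)"
  by (simp add: completion_embed_def)

lemma emb_closed: "x \<in> univ N \<Longrightarrow> emb x \<in> univ K"
  by (auto simp: completion_univ completion_embed_def const_cauchy)

lemma pred_emb:
  assumes "P \<in> pred_syms L" "length xs = pred_arity L P" "set xs \<subseteq> univ N"
  shows "pred_interp K P (map emb xs) = pred_interp N P xs"
proof -
  have "(\<lambda>n. pred_interp N P (map (\<lambda>t. t n) (map (\<lambda>x _. x) xs))) \<longlonglongrightarrow> pred_interp K P (map emb xs)"
    unfolding map_emb using assms const_cauchy by (intro completion_pred) auto
  then show ?thesis by (simp add: comp_def LIMSEQ_const_iff)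
qed

lemma fun_emb:
  assumes "f \<in> fun_syms L" "length xs = fun_arity L f" "set xs \<subseteq> univ N"
  shows "fun_interp K f (map emb xs) = emb (fun_interp N f xs)"
proof -
  have "fun_interp K f (map emb xs) = cls (\<lambda>n. fun_interp N f (map (\<lambda>t. t n) (map (\<lambda>x _. x) xs)))"
    unfolding map_emb using assms const_cauchy by (intro completion_fun) auto
  then show ?thesis by (simp add: comp_def completion_embed_def)
qed

lemma eval_tm_emb:
  "is_term L t \<Longrightarrow> s ` fv_tm t \<subseteq> univ N \<Longrightarrow> eval_tm K (\<lambda>v. emb (s v)) t = emb (eval_tm N s t)"
proof (induction t)
  case (Fn f ts)
  then have "map (eval_tm K (\<lambda>v. emb (s v))) ts = map emb (map (eval_tm N s) ts)"
    by (auto simp: list_all_iff image_subset_iff)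
  moreover have "set (map (eval_tm N s) ts) \<subseteq> univ N"
    using Fn.prems by (intro map_eval_tm_closed) (auto simp: list_all_iff)
  ultimately show ?case
    using fun_emb[of f "map (eval_tm N s) ts"] Fn.prems by (simp only: eval_tm.simps is_term.simps length_map)
qed simp

lemma emb_dense:
  assumes "X \<in> univ K" "0 < e"
  obtains x where "x \<in> univ N" "sdist L K (emb x) X < e"
proof -
  obtain t where t: "t \<in> cauchy_seqs L N" "X = cls t" using assms(1) completion_univ by auto
  \<comment> \<open>Passing to the limit in \<open>n\<close> weakens the strict inequality, hence
    the margin \<open>e / 2\<close>.\<close>
  obtain k where k: "\<forall>m\<ge>k. \<forall>n\<ge>k. D (t m) (t n) < e / 2"
    using t(1) half_gt_zero[OF assms(2)] unfolding cauchy_seqs_def by blast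
  have "(\<lambda>n. D (t k) (t n)) \<longlonglongrightarrow> sdist L K (emb (t k)) X"
    using completion_pred[of "dist_sym L" "[\<lambda>_. t k, t]"] signature t const_cauchy cauchy_seqs_closed
    by (simp add: is_signature_def sdist_def completion_embed_def)
  then have "sdist L K (emb (t k)) X \<le> e / 2"
    using k by (intro LIMSEQ_le_const2) (auto intro: less_imp_le)
  then have "sdist L K (emb (t k)) X < e" using assms(2) by linarith
  with cauchy_seqs_closed[OF t(1)] show thesis by (rule that)
qed

text \<open>A quantifier over the completion also meets points outside the image of
  \<open>N\<close>. Uniform continuity lets a nearby embedded point stand in for such a
  point.\<close>

lemma eval_emb_dense:
  assumes \<phi>: "is_formula L \<phi>" and s: "s ` (fv \<phi> - {x}) \<subseteq> univ K" and X: "X \<in> univ K" and "0 < e"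
  obtains b where "b \<in> univ N" "\<bar>eval L K (s(x := emb b)) \<phi> - eval L K (s(x := X)) \<phi>\<bar> < e"
proof -
  interpret K: pre_structure L K by (rule pre_structure_completion)
  have "s(x := X) ` fv \<phi> \<subseteq> univ K" using s X by auto
  then obtain r where r: "K.in_ball r (fv \<phi>) (s(x := X))" using K.in_ballE finite_fv by metis
  obtain \<delta> where \<delta>: "0 < \<delta>"
    "\<And>s s'. K.near \<delta> (r + 1) (fv \<phi>) s s' \<Longrightarrow> \<bar>eval L K s \<phi> - eval L K s' \<phi>\<bar> < e"
    using K.eval_uniformly_continuous[OF \<phi> \<open>0 < e\<close>] by metis
  \<comment> \<open>Distance below 1 keeps the gauge of the approximating point within 1 of that of
    \<open>X\<close>, so the radius \<open>r + 1\<close> covers both assignments.\<close>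
  have "0 < min \<delta> 1" using \<delta>(1) by simp
  then obtain b where b: "b \<in> univ N" "sdist L K (emb b) X < min \<delta> 1"
    using emb_dense[OF X] by metis
  have "sgauge L K (emb b) < sgauge L K X + 1"
    using K.gauge_lipschitz[OF emb_closed[OF b(1)] X] b(2) by linarith
  then have "K.near \<delta> (r + 1) (fv \<phi>) (s(x := emb b)) (s(x := X))"
    using r b \<delta>(1) emb_closed K.dist_refl by (fastforce simp: K.near_def K.in_ball_def)
  with b(1) \<delta>(2) that show thesis by blast
qed

end


section \<open>Ultraproducts\<close>

text \<open>Compactness gives a cluster point of the image filter. If \<open>f\<close> were not
  eventually in an open neighbourhood of it, the ultrafilter would make \<open>f\<close> eventually
  avoid that neighbourhood, contradicting clustering.\<close>

lemma ultrafilter_tendsto: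
  fixes f :: "'i \<Rightarrow> 'a::topological_space"
  assumes U: "ultrafilter U" and "compact C" "\<forall>\<^sub>F i in U. f i \<in> C"
  shows "\<exists>l\<in>C. (f \<longlongrightarrow> l) U"
proof -
  have "filtermap f U \<noteq> bot" using U by (simp add: ultrafilter_def filtermap_bot_iff)
  moreover have "\<forall>\<^sub>F y in filtermap f U. y \<in> C" using assms(3) by (simp add: eventually_filtermap)
  ultimately obtain l where l: "l \<in> C" "inf (nhds l) (filtermap f U) \<noteq> bot"
    using \<open>compact C\<close>[unfolded compact_filter, rule_format, of "filtermap f U"] by blast
  have "\<forall>\<^sub>F i in U. f i \<in> S" if "open S" "l \<in> S" for S
  proof (rule ccontr)
    assume "\<not> (\<forall>\<^sub>F i in U. f i \<in> S)"
    then have "\<forall>\<^sub>F y in filtermap f U. y \<notin> S" using U by (auto simp: ultrafilter_def eventually_filtermap)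
    moreover have "\<forall>\<^sub>F y in nhds l. y \<in> S" using that by (auto simp: eventually_nhds)
    ultimately have "\<forall>\<^sub>F y in inf (nhds l) (filtermap f U). False"
      unfolding eventually_inf by (intro exI[of _ "\<lambda>y. y \<in> S"] exI[of _ "\<lambda>y. y \<notin> S"]) simp
    with l(2) show False by (simp add: trivial_limit_def)
  qed
  with l(1) show ?thesis by (auto intro: topological_tendstoI)
qed

text \<open>Translates the maximum metric into coordinatewise form. Positivity of \<open>e\<close>
  covers the empty tuple, whose distance is 0.\<close>

lemma tuple_dist_less:
  assumes "length xs = length ys" "0 < e"
  shows "tuple_dist d xs ys < e \<longleftrightarrow> list_all2 (\<lambda>x y. d x y < e) xs ys"
proof (cases "xs = []")
  case False
  have "{d (xs ! i) (ys ! i) |i. i < length xs} = (\<lambda>i. d (xs ! i) (ys ! i)) ` {..<length xs}" by auto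
  moreover have "{..<length xs} \<noteq> {}" using False by (simp add: lessThan_empty_iff)
  ultimately show ?thesis
    using False assms(1) by (auto simp: tuple_dist_def list_all2_conv_all_nth Max_less_iff)
qed (use assms in \<open>simp add: tuple_dist_def\<close>)

lemma tuple_gauge_less: "0 < r \<Longrightarrow> tuple_gauge \<nu> xs < r \<longleftrightarrow> (\<forall>x\<in>set xs. \<nu> x < r)"
  by (cases "xs = []") (auto simp: tuple_gauge_def)

lemma pre_structure_structure:
  assumes L: "is_signature L" and M: "is_structure L M"
  shows "pre_structure L M"
proof -
  let ?D = "sdist L M" and ?G = "sgauge L M"
  have gauged: "Metric_space (univ M) (cut (univ M) ?D)"
    "\<And>x y. x \<in> univ M \<Longrightarrow> y \<in> univ M \<Longrightarrow> \<bar>?G x - ?G y\<bar> \<le> ?D x y"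
    using M by (auto simp: is_structure_def complete_gauged_space_def gauged_space_def)
  interpret Metric_space "univ M" "cut (univ M) ?D" by (rule gauged)
  have modulus: "f \<in> fun_syms L \<Longrightarrow> 0 < e \<Longrightarrow> 0 < fun_modulus L f e"
    "P \<in> pred_syms L \<Longrightarrow> 0 < e \<Longrightarrow> 0 < pred_modulus L P e" for f P e
    using L by (auto simp: is_signature_def continuity_modulus_def)
  show ?thesis
  proof
    show "is_signature L" by (rule L)
  next
    fix x assume "x \<in> univ M"
    then show "?D x x = 0" using zero[of x x] by (simp add: cut_def)
  next
    fix x y assume *: "x \<in> univ M" "y \<in> univ M"
    then show "?D x y = ?D y x" using commute[of x y] by (simp add: cut_def)
    show "\<bar>?G x - ?G y\<bar> \<le> ?D x y" using gauged(2) * .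
  next
    fix x y z assume "x \<in> univ M" "y \<in> univ M" "z \<in> univ M"
    then show "?D x z \<le> ?D x y + ?D y z" using triangle[of x y z] by (simp add: cut_def)
  next
    fix f xs assume "f \<in> fun_syms L" "length xs = fun_arity L f" "set xs \<subseteq> univ M"
    then show "fun_interp M f xs \<in> univ M" using M by (auto simp: is_structure_def tuples_def)
  next
    fix P xs assume "P \<in> pred_syms L" "length xs = pred_arity L P" "set xs \<subseteq> univ M"
    then show "0 \<le> pred_interp M P xs" using M by (auto simp: is_structure_def tuples_def Pi_iff)
  next
    fix f xs ys e
    assume *: "f \<in> fun_syms L" "length xs = fun_arity L f" "set xs \<subseteq> univ M" "set ys \<subseteq> univ M" "0 < e"
      "\<And>x. x \<in> set xs \<union> set ys \<Longrightarrow> ?G x < 1 / e"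
      "list_all2 (\<lambda>x y. ?D x y < fun_modulus L f e) xs ys"
    then have "length ys = length xs" by (simp add: list_all2_lengthD)
    then have "tuple_gauge ?G xs < 1 / e" "tuple_gauge ?G ys < 1 / e"
      "tuple_dist ?D xs ys < fun_modulus L f e"
      using * modulus by (simp_all add: tuple_gauge_less tuple_dist_less)
    then show "?D (fun_interp M f xs) (fun_interp M f ys) \<le> e \<and>
        ?G (fun_interp M f xs) \<le> 1 / fun_modulus L f e"
      using M * \<open>length ys = length xs\<close> unfolding is_structure_def respects_modulus_def
      by (auto simp: tuples_def)
  next
    fix P xs ys e
    assume *: "P \<in> pred_syms L" "length xs = pred_arity L P" "set xs \<subseteq> univ M" "set ys \<subseteq> univ M" "0 < e"
      "\<And>x. x \<in> set xs \<union> set ys \<Longrightarrow> ?G x < 1 / e"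
      "list_all2 (\<lambda>x y. ?D x y < pred_modulus L P e) xs ys"
    then have "length ys = length xs" by (simp add: list_all2_lengthD)
    then have "tuple_gauge ?G xs < 1 / e" "tuple_gauge ?G ys < 1 / e"
      "tuple_dist ?D xs ys < pred_modulus L P e"
      using * modulus by (simp_all add: tuple_gauge_less tuple_dist_less)
    then show "\<bar>pred_interp M P xs - pred_interp M P ys\<bar> \<le> e \<and>
        pred_interp M P xs \<le> 1 / pred_modulus L P e"
      using M * \<open>length ys = length xs\<close> unfolding is_structure_def respects_modulus_def
      by (auto simp: tuples_def dist_real_def)
  qed
qed

section \<open>The pre-ultraproduct and its completion as pre-structures\<close>

locale ultraproduct_family =
  fixes L :: "('f, 'p) signature" and U :: "'i filter" and M :: "'i \<Rightarrow> ('a, 'f, 'p) struct"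
  assumes sig: "is_signature L" and pre_struct: "\<And>i. pre_structure L (M i)" and ultra: "ultrafilter U"
begin

abbreviation "N0 \<equiv> pre_ultraproduct L U M"
abbreviation "I0 \<equiv> nonempty_indices M"

sublocale M: pre_structure L "M i" for i by (rule pre_struct)

lemma U_nontrivial: "U \<noteq> bot"
  using ultra by (simp add: ultrafilter_def)

text \<open>The extended reals are compact, so the gauges do converge along \<open>U\<close> and
  \<open>Lim\<close> is a genuine limit; below \<open>\<infinity>\<close> it forces an eventual
  bound. Conversely, non-negativity traps eventually bounded gauges in a compact real interval,
  which makes the limit real.\<close>

lemma in_pre_ultraproduct_iff:
  "a \<in> univ N0 \<longleftrightarrow> (\<forall>\<^sub>F i in U. i \<in> I0) \<and> a \<in> Pi\<^sub>E I0 (\<lambda>i. univ (M i)) \<and>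
    (\<exists>r. \<forall>\<^sub>F i in U. sgauge L (M i) (a i) < r)"
proof -
  have "Lim U (\<lambda>i. ereal (sgauge L (M i) (a i))) < \<infinity> \<longleftrightarrow> (\<exists>r. \<forall>\<^sub>F i in U. sgauge L (M i) (a i) < r)"
    (is "Lim U ?g < \<infinity> \<longleftrightarrow> ?bounded")
    if I0: "\<forall>\<^sub>F i in U. i \<in> I0" "a \<in> Pi\<^sub>E I0 (\<lambda>i. univ (M i))"
  proof
    obtain l where "(?g \<longlongrightarrow> l) U" using ultrafilter_tendsto[OF ultra compact_UNIV, of ?g] by auto
    then have lim: "(?g \<longlongrightarrow> Lim U ?g) U" using tendsto_Lim[OF U_nontrivial] by blast
    assume "Lim U ?g < \<infinity>"
    then obtain r where "Lim U ?g < ereal r" using less_PInf_Ex_of_nat by auto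
    then have "\<forall>\<^sub>F i in U. sgauge L (M i) (a i) < r" using order_tendstoD(2)[OF lim, of "ereal r"] by simp
    then show ?bounded ..
  next
    assume ?bounded
    then obtain r where "\<forall>\<^sub>F i in U. sgauge L (M i) (a i) < r" ..
    then have bounded: "\<forall>\<^sub>F i in U. sgauge L (M i) (a i) \<in> {0..r}"
      using I0(1)
    proof eventually_elim
      case (elim i)
      then have "a i \<in> univ (M i)" using I0(2) by (auto simp: PiE_def)
      with elim show ?case using M.gauge_nonneg by simp
    qed
    obtain l where "((\<lambda>i. sgauge L (M i) (a i)) \<longlongrightarrow> l) U"
      using ultrafilter_tendsto[OF ultra compact_Icc bounded] by blast
    then have "Lim U ?g = ereal l" by (intro tendsto_Lim U_nontrivial tendsto_ereal)
    then show "Lim U ?g < \<infinity>" by simp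
  qed
  then show ?thesis by (auto simp: pre_ultraproduct_def)
qed

lemma pre_ultraproduct_closed: "a \<in> univ N0 \<Longrightarrow> i \<in> I0 \<Longrightarrow> a i \<in> univ (M i)"
  by (auto simp: in_pre_ultraproduct_iff PiE_def)

lemma pre_ultraproduct_fun_apply:
  "i \<in> I0 \<Longrightarrow> fun_interp N0 f as i = fun_interp (M i) f (map (\<lambda>a. a i) as)"
  by (simp add: pre_ultraproduct_def)

lemma pre_ultraproduct_list:
  "set as \<subseteq> univ N0 \<Longrightarrow>
    \<exists>r. \<forall>\<^sub>F i in U. \<forall>x\<in>set (map (\<lambda>a. a i) as). x \<in> univ (M i) \<and> sgauge L (M i) x < r"
proof (induction as)
  case (Cons a as)
  then obtain r where
    r: "\<forall>\<^sub>F i in U. \<forall>x\<in>set (map (\<lambda>a. a i) as). x \<in> univ (M i) \<and> sgauge L (M i) x < r" by auto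
  have a: "a \<in> univ N0" using Cons.prems by simp
  then obtain r' where "\<forall>\<^sub>F i in U. i \<in> I0" "\<forall>\<^sub>F i in U. sgauge L (M i) (a i) < r'"
    by (auto simp: in_pre_ultraproduct_iff)
  with r have "\<forall>\<^sub>F i in U. \<forall>x\<in>set (map (\<lambda>a. a i) (a # as)).
      x \<in> univ (M i) \<and> sgauge L (M i) x < max r r'"
    by eventually_elim (auto simp: less_max_iff_disj pre_ultraproduct_closed[OF a])
  then show ?case ..
qed simp

lemma pre_ultraproduct_radius:
  assumes "set as \<subseteq> univ N0"
  obtains e where "0 < e"
    "\<forall>\<^sub>F i in U. \<forall>x\<in>set (map (\<lambda>a. a i) as). x \<in> univ (M i) \<and> sgauge L (M i) x < 1 / e"
proof -
  obtain r where
    r: "\<forall>\<^sub>F i in U. \<forall>x\<in>set (map (\<lambda>a. a i) as). x \<in> univ (M i) \<and> sgauge L (M i) x < r"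
    using pre_ultraproduct_list[OF assms] by blast
  have "r \<le> 1 / (1 / max r 1)" by simp
  then have "\<forall>\<^sub>F i in U. \<forall>x\<in>set (map (\<lambda>a. a i) as).
      x \<in> univ (M i) \<and> sgauge L (M i) x < 1 / (1 / max r 1)"
    using r by (auto elim!: eventually_mono)
  then show thesis by (intro that[of "1 / max r 1"]) simp
qed

text \<open>The arguments eventually lie in one gauge ball, so the modulus confines the values to a
  compact interval, and \<open>Lim\<close> in the definition is an actual limit.\<close>

lemma pre_ultraproduct_pred:
  assumes P: "P \<in> pred_syms L" "length as = pred_arity L P" and as: "set as \<subseteq> univ N0"
  shows "((\<lambda>i. pred_interp (M i) P (map (\<lambda>a. a i) as)) \<longlongrightarrow> pred_interp N0 P as) U"
proof -
  let ?p = "\<lambda>i. pred_interp (M i) P (map (\<lambda>a. a i) as)"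
  obtain e where e: "0 < e"
    "\<forall>\<^sub>F i in U. \<forall>x\<in>set (map (\<lambda>a. a i) as). x \<in> univ (M i) \<and> sgauge L (M i) x < 1 / e"
    using pre_ultraproduct_radius[OF as] .
  from e(2) have bounded: "\<forall>\<^sub>F i in U. ?p i \<in> {0..1 / pred_modulus L P e}"
  proof eventually_elim
    case (elim i)
    then have as: "set (map (\<lambda>a. a i) as) \<subseteq> univ (M i)" by blast
    have "?p i \<le> 1 / pred_modulus L P e"
      using elim P(2) by (intro M.pred_bound[OF P(1) _ as e(1)]) auto
    then show ?case using M.pred_nonneg[OF P(1) _ as] P(2) by simp
  qed
  obtain l where "(?p \<longlongrightarrow> l) U"
    using ultrafilter_tendsto[OF ultra compact_Icc bounded] by blast
  then show ?thesis
    using tendsto_Lim[OF U_nontrivial, of ?p l] by (simp add: pre_ultraproduct_def)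
qed

lemma pre_ultraproduct_fun:
  assumes f: "f \<in> fun_syms L" "length as = fun_arity L f" and as: "set as \<subseteq> univ N0"
  shows "fun_interp N0 f as \<in> univ N0" "\<forall>\<^sub>F i in U. i \<in> I0"
proof -
  show I0: "\<forall>\<^sub>F i in U. i \<in> I0"
  \<comment> \<open>A constant symbol makes every \<open>M i\<close> nonempty; with at least one
    argument, membership of that argument in \<open>N0\<close> gives the claim.\<close>
  proof (cases as)
    case Nil
    then have "fun_interp (M i) f [] \<in> univ (M i)" for i using f by (intro M.fun_closed) auto
    then have "i \<in> I0" for i by (auto simp: nonempty_indices_def)
    then show ?thesis by simp
  qed (use as in \<open>auto simp: in_pre_ultraproduct_iff\<close>)
  obtain e where e: "0 < e"
    "\<forall>\<^sub>F i in U. \<forall>x\<in>set (map (\<lambda>a. a i) as). x \<in> univ (M i) \<and> sgauge L (M i) x < 1 / e"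
    using pre_ultraproduct_radius[OF as] .
  have "fun_interp N0 f as \<in> Pi\<^sub>E I0 (\<lambda>i. univ (M i))"
  proof (rule PiE_I)
    fix i assume i: "i \<in> I0"
    then have "set (map (\<lambda>a. a i) as) \<subseteq> univ (M i)" using as pre_ultraproduct_closed by auto
    then show "fun_interp N0 f as i \<in> univ (M i)"
      using M.fun_closed[OF f(1)] f(2) pre_ultraproduct_fun_apply[OF i] by simp
  qed (simp add: pre_ultraproduct_def)
  moreover from e(2) I0 have "\<forall>\<^sub>F i in U. sgauge L (M i) (fun_interp N0 f as i) < 1 / fun_modulus L f e + 1"
  proof eventually_elim
    case (elim i)
    then have "set (map (\<lambda>a. a i) as) \<subseteq> univ (M i)" by blast
    then have "sgauge L (M i) (fun_interp (M i) f (map (\<lambda>a. a i) as)) \<le> 1 / fun_modulus L f e"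
      using elim f(2) by (intro M.fun_gauge_bound[OF f(1) _ _ e(1)]) auto
    then show ?case using pre_ultraproduct_fun_apply[OF elim(2)] by simp
  qed
  ultimately show "fun_interp N0 f as \<in> univ N0" using I0 by (auto simp: in_pre_ultraproduct_iff)
qed

sublocale N0: pre_structure L N0
proof (rule pre_structure_limit[where F = U and N = M and q = "\<lambda>a. a" and C = "univ N0"])
  fix f as assume *: "f \<in> fun_syms L" "length as = fun_arity L f" "set as \<subseteq> univ N0"
  \<comment> \<open>The interpretation is restricted to \<open>I0\<close>, so the coordinatewise
    formula is claimed only eventually.\<close>
  have "\<forall>\<^sub>F i in U. fun_interp N0 f as i = fun_interp (M i) f (map (\<lambda>a. a i) as)"
    using pre_ultraproduct_fun(2)[OF *]
    by eventually_elim (rule pre_ultraproduct_fun_apply)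
  then show "\<exists>b\<in>univ N0. fun_interp N0 f (map (\<lambda>a. a) as) = b \<and>
      (\<forall>\<^sub>F i in U. b i = fun_interp (M i) f (map (\<lambda>a. a i) as))"
    using pre_ultraproduct_fun(1)[OF *] by simp
next
  fix a assume a: "a \<in> univ N0"
  then have "\<forall>\<^sub>F i in U. i \<in> I0" by (simp add: in_pre_ultraproduct_iff)
  then show "\<forall>\<^sub>F i in U. a i \<in> univ (M i)"
    by eventually_elim (rule pre_ultraproduct_closed[OF a])
qed (simp_all add: U_nontrivial sig pre_struct pre_ultraproduct_pred)

abbreviation "K \<equiv> ultraproduct L U M"

sublocale K: pre_structure L K
  unfolding ultraproduct_def by (rule N0.pre_structure_completion)

abbreviation "cl \<equiv> ultra_class L U M"

lemma cl_closed: "b \<in> univ N0 \<Longrightarrow> cl b \<in> univ K"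
  unfolding ultra_class_def ultraproduct_def by (rule N0.emb_closed)

section \<open>Convergence of the values of formulae along the ultrafilter\<close>

lemma eval_tm_pre_ultraproduct:
  "i \<in> I0 \<Longrightarrow> eval_tm N0 a t i = eval_tm (M i) (\<lambda>v. a v i) t"
proof (induction t)
  case (Fn f ts)
  then have "map (\<lambda>b. b i) (map (eval_tm N0 a) ts) = map (eval_tm (M i) (\<lambda>v. a v i)) ts" by simp
  then show ?case
    using pre_ultraproduct_fun_apply[OF Fn.prems, of f "map (eval_tm N0 a) ts"] by (simp only: eval_tm.simps)
qed simp

lemma eval_Atom_tendsto:
  assumes \<phi>: "is_formula L (Atom P ts)" and a: "a ` fv (Atom P ts) \<subseteq> univ N0"
  shows "((\<lambda>i. eval L (M i) (\<lambda>v. a v i) (Atom P ts)) \<longlongrightarrow>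
    eval L K (\<lambda>v. cl (a v)) (Atom P ts)) U"
proof -
  let ?bs = "map (eval_tm N0 a) ts"
  have P: "P \<in> pred_syms L" "length ts = pred_arity L P" "\<And>t. t \<in> set ts \<Longrightarrow> is_term L t"
    using \<phi> by auto
  have bs: "set ?bs \<subseteq> univ N0" using P(3) a by (intro N0.map_eval_tm_closed) auto
  have "map (eval_tm K (\<lambda>v. cl (a v))) ts = map N0.emb ?bs"
    using P(3) a unfolding ultraproduct_def ultra_class_def
    by (auto intro!: N0.eval_tm_emb)
  then have "eval L K (\<lambda>v. cl (a v)) (Atom P ts) = pred_interp N0 P ?bs"
    using N0.pred_emb[OF P(1) _ bs] P(2) by (simp add: ultraproduct_def del: map_map)
  moreover have "\<forall>\<^sub>F i in U. pred_interp (M i) P (map (\<lambda>b. b i) ?bs) = eval L (M i) (\<lambda>v. a v i) (Atom P ts)"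
  \<comment> \<open>Any term supplies a point of \<open>N0\<close>, hence \<open>I0\<close> is
    large; for a nullary predicate there is no term to evaluate.\<close>
  proof (cases ts)
    case (Cons t ts')
    then have "eval_tm N0 a t \<in> univ N0" using bs by simp
    then have "\<forall>\<^sub>F i in U. i \<in> I0" by (simp add: in_pre_ultraproduct_iff)
    then show ?thesis
      by eventually_elim (simp add: eval_tm_pre_ultraproduct comp_def)
  qed simp
  ultimately show ?thesis
    using pre_ultraproduct_pred[OF P(1) _ bs] P(2) by (auto intro: Lim_transform_eventually)
qed

text \<open>By \<open>tendsto_Sup\<close> and \<open>tendsto_Inf\<close> two estimates suffice. Each
  value on the ultraproduct is approximated through an embedded point. The uniform estimate is by
  contradiction: its failure on a \<open>U\<close>-large set yields far-off witnesses, which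
  assemble to a point of \<open>N0\<close> whose value on the ultraproduct they must
  approach.\<close>

lemma eval_quant_tendsto:
  assumes \<phi>: "is_formula L \<phi>" "ev_const L x \<phi>" and a: "a ` (fv \<phi> - {x}) \<subseteq> univ N0"
    and IH_inf: "((\<lambda>i. eval L (M i) (\<lambda>v. a v i) (at_inf L x \<phi>)) \<longlongrightarrow>
      eval L K (\<lambda>v. cl (a v)) (at_inf L x \<phi>)) U"
    and IH: "\<And>a. a ` fv \<phi> \<subseteq> univ N0 \<Longrightarrow>
      ((\<lambda>i. eval L (M i) (\<lambda>v. a v i) \<phi>) \<longlongrightarrow> eval L K (\<lambda>v. cl (a v)) \<phi>) U"
  shows "((\<lambda>i. eval L (M i) (\<lambda>v. a v i) (SupF x \<phi>)) \<longlongrightarrow> eval L K (\<lambda>v. cl (a v)) (SupF x \<phi>)) U"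
    and "((\<lambda>i. eval L (M i) (\<lambda>v. a v i) (InfF x \<phi>)) \<longlongrightarrow> eval L K (\<lambda>v. cl (a v)) (InfF x \<phi>)) U"
proof -
  let ?s = "\<lambda>i v. a v i" and ?t = "\<lambda>v. cl (a v)"
  let ?S = "\<lambda>i. M.quant_vals i (?s i) x \<phi>" and ?A = "K.quant_vals ?t x \<phi>"
  note M_regular = M.regular_formula[OF \<phi>(1)] M.regular_formula[OF is_formula_at_inf[OF \<phi>(1)]]
  note K_regular = K.regular_formula[OF \<phi>(1)] K.regular_formula[OF is_formula_at_inf[OF \<phi>(1)]]
  have t: "?t ` (fv \<phi> - {x}) \<subseteq> univ K" using a cl_closed by blast
  have upd: "(\<lambda>v. (a(x := b)) v i) = (?s i)(x := b i)" "(\<lambda>v. cl ((a(x := b)) v)) = ?t(x := cl b)" for b i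
    by (auto simp: fun_eq_iff)
  have IH_upd: "((\<lambda>i. eval L (M i) ((?s i)(x := b i)) \<phi>) \<longlongrightarrow> eval L K (?t(x := cl b)) \<phi>) U"
    if "b \<in> univ N0" for b
  proof -
    have "a(x := b) ` fv \<phi> \<subseteq> univ N0" using a that by auto
    from IH[OF this] show ?thesis unfolding upd .
  qed
  have s: "\<forall>\<^sub>F i in U. ?s i ` (fv \<phi> - {x}) \<subseteq> univ (M i)"
  \<comment> \<open>Without free variables \<open>I0\<close> need not be large, but then the claim
    is vacuous.\<close>
  proof (cases "fv \<phi> - {x} = {}")
    case True
    then show ?thesis unfolding True by simp
  next
    case False
    then obtain v where "a v \<in> univ N0" using a by blast
    then have "\<forall>\<^sub>F i in U. i \<in> I0" by (simp add: in_pre_ultraproduct_iff)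
    then show ?thesis by eventually_elim (use a pre_ultraproduct_closed in blast)
  qed
  have lower: "\<forall>\<^sub>F i in U. \<exists>y\<in>?S i. \<bar>y - z\<bar> < e" if z: "z \<in> ?A" and e: "0 < e" for z e
  proof -
    from z consider "z = eval L K ?t (at_inf L x \<phi>)"
      | X where "X \<in> univ K" "z = eval L K (?t(x := X)) \<phi>"
      by (auto simp: K.quant_vals_def)
    then show ?thesis
    proof cases
      case 1
      from tendstoD[OF IH_inf e] show ?thesis
        by eventually_elim (use 1 in \<open>auto simp: M.quant_vals_def dist_real_def\<close>)
    next
      case 2
      \<comment> \<open>One half for approximating \<open>X\<close> by an embedded point, one half
        for the convergence at that point.\<close>
      have e2: "0 < e / 2" using e by simp
      obtain b where b: "b \<in> univ N0" "\<bar>eval L K (?t(x := cl b)) \<phi> - z\<bar> < e / 2"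
        using N0.eval_emb_dense[OF \<phi>(1) t[unfolded ultraproduct_def] 2(1)[unfolded ultraproduct_def] e2]
        unfolding 2(2) ultraproduct_def ultra_class_def by metis
      have "\<forall>\<^sub>F i in U. i \<in> I0" using b(1) by (simp add: in_pre_ultraproduct_iff)
      with tendstoD[OF IH_upd[OF b(1)] e2] show ?thesis
      proof eventually_elim
        case (elim i)
        then have "\<bar>eval L (M i) ((?s i)(x := b i)) \<phi> - z\<bar> < e"
          using b(2) unfolding dist_real_def by linarith
        then show ?case
          using pre_ultraproduct_closed[OF b(1) elim(2)] by (auto simp: M.quant_vals_def)
      qed
    qed
  qed
  have upper: "\<forall>\<^sub>F i in U. \<forall>y\<in>?S i. \<exists>z\<in>?A. \<bar>y - z\<bar> < e" if e: "0 < e" for e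
  proof (rule ccontr)
    let ?far = "\<lambda>y. \<forall>z\<in>?A. \<not> \<bar>y - z\<bar> < e"
    \<comment> \<open>The gauge condition is part of the choice: its bound does not depend on
      \<open>i\<close>, so the chosen points have bounded gauge along \<open>U\<close>.\<close>
    let ?P = "\<lambda>i b. b \<in> univ (M i) \<and> sgauge L (M i) b < fm_size \<phi> \<and>
      ?far (eval L (M i) ((?s i)(x := b)) \<phi>)"
    assume "\<not> ?thesis"
    then have "\<forall>\<^sub>F i in U. \<not> (\<forall>y\<in>?S i. \<exists>z\<in>?A. \<bar>y - z\<bar> < e)"
      using ultra unfolding ultrafilter_def by blast
    then have ex: "\<forall>\<^sub>F i in U. \<exists>b. ?P i b"
      using s tendstoD[OF IH_inf e]
    proof eventually_elim
      case (elim i)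
      then obtain y where y: "y \<in> ?S i" "?far y" by blast
      \<comment> \<open>By \<open>IH_inf\<close> the value at \<open>\<infinity>\<close> is not far
        from \<open>?A\<close>. A far value thus comes from a genuine point, and one below the
        threshold, since beyond it the value would be that at \<open>\<infinity>\<close>.\<close>
      have inf: "\<not> ?far (eval L (M i) (?s i) (at_inf L x \<phi>))"
        using elim(3) by (auto simp: K.quant_vals_def dist_real_def)
      with y obtain b where b: "b \<in> univ (M i)" "y = eval L (M i) ((?s i)(x := b)) \<phi>"
        by (auto simp: M.quant_vals_def)
      have "sgauge L (M i) b < fm_size \<phi>"
        using M.eval_beyond_threshold[OF \<phi> M_regular elim(2) b(1)] inf y(2) b(2) by fastforce
      then show ?case using y(2) b by blast
    qed
    \<comment> \<open>Where no witness exists any point will do, and outside \<open>I0\<close> the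
      value is \<open>undefined\<close>, as membership in \<open>Pi\<^sub>E\<close> demands.\<close>
    define b where "b = (\<lambda>i. if i \<in> I0 then
      (if \<exists>c. ?P i c then SOME c. ?P i c else SOME c. c \<in> univ (M i)) else undefined)"
    have P: "?P i (b i)" if "\<exists>c. ?P i c" for i
    proof -
      have "i \<in> I0" using that by (auto simp: nonempty_indices_def)
      then have "b i = (SOME c. ?P i c)" unfolding b_def using that by (simp only: if_True)
      with someI_ex[OF that] show ?thesis by simp
    qed
    have "b \<in> Pi\<^sub>E I0 (\<lambda>i. univ (M i))"
    proof (rule PiE_I)
      fix i assume i: "i \<in> I0"
      show "b i \<in> univ (M i)"
      proof (cases "\<exists>c. ?P i c")
        case False
        have "b i = (SOME c. c \<in> univ (M i))"
          unfolding b_def if_P[OF i] by (rule if_not_P[OF False])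
        then show ?thesis using i by (simp add: nonempty_indices_def some_in_eq)
      qed (use P in blast)
    qed (simp add: b_def)
    moreover have "\<forall>\<^sub>F i in U. i \<in> I0"
      using ex by eventually_elim (auto simp: nonempty_indices_def)
    moreover have "\<forall>\<^sub>F i in U. sgauge L (M i) (b i) < fm_size \<phi>"
      using ex by eventually_elim (use P in blast)
    ultimately have b: "b \<in> univ N0" unfolding in_pre_ultraproduct_iff by blast
    then have mem: "eval L K (?t(x := cl b)) \<phi> \<in> ?A" using cl_closed by (auto simp: K.quant_vals_def)
    from ex tendstoD[OF IH_upd[OF b] e] have "\<forall>\<^sub>F i in U. False"
    proof eventually_elim
      case (elim i)
      from P[OF elim(1)] mem have "\<not> dist (eval L (M i) ((?s i)(x := b i)) \<phi>) (eval L K (?t(x := cl b)) \<phi>) < e"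
        unfolding dist_real_def by blast
      with elim(2) show False by contradiction
    qed
    then show False using U_nontrivial by (simp add: trivial_limit_def)
  qed
  have bdd: "\<forall>\<^sub>F i in U. bdd_above (?S i)" "\<forall>\<^sub>F i in U. bdd_below (?S i)"
    by (rule eventually_mono[OF s], rule M.quant_vals_bdd[OF \<phi> M_regular], assumption)+
  show "((\<lambda>i. eval L (M i) (?s i) (SupF x \<phi>)) \<longlongrightarrow> eval L K ?t (SupF x \<phi>)) U"
    unfolding M.eval_SupF K.eval_SupF
    by (rule tendsto_Sup[OF K.quant_vals_nonempty K.quant_vals_bdd(1)[OF \<phi> K_regular t]
          M.quant_vals_nonempty bdd(1) lower upper])
  show "((\<lambda>i. eval L (M i) (?s i) (InfF x \<phi>)) \<longlongrightarrow> eval L K ?t (InfF x \<phi>)) U"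
    unfolding M.eval_InfF K.eval_InfF
    by (rule tendsto_Inf[OF K.quant_vals_nonempty K.quant_vals_bdd(2)[OF \<phi> K_regular t]
          M.quant_vals_nonempty bdd(2) lower upper])
qed

text \<open>The family \<open>a\<close> is generalised in the induction because the quantifier step
  updates it at \<open>x\<close> with points of \<open>N0\<close>.\<close>

lemma eval_tendsto:
  "is_formula L \<phi> \<Longrightarrow> a ` fv \<phi> \<subseteq> univ N0 \<Longrightarrow>
    ((\<lambda>i. eval L (M i) (\<lambda>v. a v i) \<phi>) \<longlongrightarrow> eval L K (\<lambda>v. cl (a v)) \<phi>) U"
proof (induction \<phi> arbitrary: a rule: measure_induct_rule[where f = fm_size])
  case (less \<phi>)
  have at_inf: "((\<lambda>i. eval L (M i) (\<lambda>v. a v i) (at_inf L x \<psi>)) \<longlongrightarrow>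
      eval L K (\<lambda>v. cl (a v)) (at_inf L x \<psi>)) U"
    if "fm_size \<psi> < fm_size \<phi>" "is_formula L \<psi>" "ev_const L x \<psi>" "fv \<psi> - {x} = fv \<phi>" for x \<psi>
  proof (rule less.IH)
    show "fm_size (at_inf L x \<psi>) < fm_size \<phi>" using fm_size_at_inf that(1) by (rule le_less_trans)
    show "is_formula L (at_inf L x \<psi>)" using that(2) by (rule is_formula_at_inf)
    show "a ` fv (at_inf L x \<psi>) \<subseteq> univ N0"
      using fv_at_inf[OF that(3)] that(4) less.prems(2) by fast
  qed
  show ?case
  proof (cases \<phi>)
    case (Atom P ts)
    show ?thesis using eval_Atom_tendsto[of P ts a] less.prems unfolding Atom by blast
  next
    case (Monus \<psi> \<xi>)
    then have "((\<lambda>i. eval L (M i) (\<lambda>v. a v i) \<psi>) \<longlongrightarrow> eval L K (\<lambda>v. cl (a v)) \<psi>) U"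
      "((\<lambda>i. eval L (M i) (\<lambda>v. a v i) \<xi>) \<longlongrightarrow> eval L K (\<lambda>v. cl (a v)) \<xi>) U"
      using less.prems by (auto intro!: less.IH)
    then show ?thesis unfolding Monus eval.simps by (intro tendsto_max tendsto_diff tendsto_const)
  next
    case (Plus \<psi> \<xi>)
    then have "((\<lambda>i. eval L (M i) (\<lambda>v. a v i) \<psi>) \<longlongrightarrow> eval L K (\<lambda>v. cl (a v)) \<psi>) U"
      "((\<lambda>i. eval L (M i) (\<lambda>v. a v i) \<xi>) \<longlongrightarrow> eval L K (\<lambda>v. cl (a v)) \<xi>) U"
      using less.prems by (auto intro!: less.IH)
    then show ?thesis unfolding Plus eval.simps by (intro tendsto_add)
  next
    case (Half \<psi>)
    then have "((\<lambda>i. eval L (M i) (\<lambda>v. a v i) \<psi>) \<longlongrightarrow> eval L K (\<lambda>v. cl (a v)) \<psi>) U"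
      using less.prems by (auto intro!: less.IH)
    then show ?thesis unfolding Half eval.simps by (intro tendsto_divide tendsto_const) auto
  next
    case (SupF x \<psi>)
    then have *: "fm_size \<psi> < fm_size \<phi>" "is_formula L \<psi>" "ev_const L x \<psi>" "fv \<psi> - {x} = fv \<phi>"
      using less.prems by auto
    show ?thesis
      unfolding SupF using less.prems(2) *(4)
      by (intro eval_quant_tendsto(1) at_inf less.IH *) simp_all
  next
    case (InfF x \<psi>)
    then have *: "fm_size \<psi> < fm_size \<phi>" "is_formula L \<psi>" "ev_const L x \<psi>" "fv \<psi> - {x} = fv \<phi>"
      using less.prems by auto
    show ?thesis
      unfolding InfF using less.prems(2) *(4)
      by (intro eval_quant_tendsto(2) at_inf less.IH *) simp_all
  qed simp
qed

end

theorem theorem3p1: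
  fixes L :: "('f, 'p) signature"
    and M :: "'i \<Rightarrow> ('a, 'f, 'p) struct"
    and U :: "'i filter"
    and \<phi> :: "('f, 'p) fm"
    and a :: "nat \<Rightarrow> 'i \<Rightarrow> 'a"
  assumes "is_signature L"
    and "\<And>i. is_structure L (M i)"
    and "ultrafilter U"
    and "is_formula L \<phi>"
    and "\<And>v. v \<in> fv \<phi> \<Longrightarrow> a v \<in> univ (pre_ultraproduct L U M)"
  shows "((\<lambda>i. eval L (M i) (\<lambda>v. a v i) \<phi>) \<longlongrightarrow>
            eval L (ultraproduct L U M) (\<lambda>v. ultra_class L U M (a v)) \<phi>) U"
proof -
  interpret ultraproduct_family L U M
    by (intro ultraproduct_family.intro pre_structure_structure assms(1-3))
  show ?thesis using assms(4,5) by (intro eval_tendsto) auto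
qed

end
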